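(* Let $G$ be an infinite plain group with $S$ a standard set of generators. Then the connective constant $\mu(G,S)$ is a non-negative rational power of a Perron number.
   Context: All generating sets are finite, symmetric ($S=S^{-1}$) and do not contain the identity. A group is plain if it is isomorphic to a free product $G_1\ast\cdots\ast G_k\ast\mathbb{F}_m$ where $k\ge 0$, $m\ge0$, the $G_i$ are finite groups and $\mathbb{F}_m$ is the free group of rank $m$. A finite (symmetric) generating set $S$ of such a group is standard if, for such a decomposition, it is a disjoint union $S=S_1\cup\cdots\cup S_k\cup S_{k+1}$ where $S_i$ is a generating set of $G_i$ for $1\le i\le k$ and $S_{k+1}$ is a free generating set of $\mathbb{F}_m$ (together with inverses). The Cayley graph $\Gamma(G,S)$ has vertex set $G$ and edges between $g$ and $gs$ ($g\in G$, $s\in S$). The connective constant is $\mu(G,S)=\lim_{n\to\infty}\sqrt[n]{c_n}$, where $c_n$ is the number of self-avoiding walks (paths never visiting a vertex twice) of length $n$ in $\Gamma(G,S)$ starting at the identity. A Perron number is a real algebraic integer $\lambda\ge1$ that is strictly larger in absolute value than all its other algebraic conjugates. *)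

theory Defs
  imports
    Complex_Main
    "HOL-Algebra.Generated_Groups"
    "HOL-Computational_Algebra.Computational_Algebra"
    "Graph_Theory.Graph_Theory"
begin

section \<open>Free products\<close>

text \<open>
  An element of the free product of the family \<open>H\<close> over the index set \<open>I\<close> is a reduced word: a list
  of pairs \<open>(i, a)\<close> with \<open>a\<close> a nontrivial element of \<open>H i\<close>, consecutive letters having distinct
  indices.  Words are multiplied by concatenation followed by reduction.
\<close>

definition fp_inj :: "('i \<Rightarrow> ('a, 'c) monoid_scheme) \<Rightarrow> 'i \<Rightarrow> 'a \<Rightarrow> ('i \<times> 'a) list" where
  "fp_inj H i a = (if a = \<one>\<^bsub>H i\<^esub> then [] else [(i, a)])"

fun fp_cons :: "('i \<Rightarrow> ('a, 'c) monoid_scheme) \<Rightarrow> 'i \<times> 'a \<Rightarrow> ('i \<times> 'a) list \<Rightarrow> ('i \<times> 'a) list" where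
  "fp_cons H (i, a) [] = fp_inj H i a"
| "fp_cons H (i, a) ((j, b) # w) =
     (if i = j then fp_inj H i (a \<otimes>\<^bsub>H i\<^esub> b) @ w else fp_inj H i a @ (j, b) # w)"

definition free_product ::
  "'i set \<Rightarrow> ('i \<Rightarrow> ('a, 'c) monoid_scheme) \<Rightarrow> ('i \<times> 'a) list monoid" where
  "free_product I H =
     \<lparr>carrier = {w. (\<forall>(i, a) \<in> set w. i \<in> I \<and> a \<in> carrier (H i) \<and> a \<noteq> \<one>\<^bsub>H i\<^esub>)
                    \<and> distinct_adj (map fst w)},
      monoid.mult = (\<lambda>u v. foldr (fp_cons H) u v),
      one = []\<rparr>"

lemma fp_cons_closed:
  assumes "\<forall>i\<in>I. group (H i)" "i \<in> I" "a \<in> carrier (H i)"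
    and "w \<in> carrier (free_product I H)"
  shows "fp_cons H (i, a) w \<in> carrier (free_product I H)"
proof -
  interpret group "H i" using assms by blast
  show ?thesis using assms(2-)
    by (cases "(H, (i, a), w)" rule: fp_cons.cases)
       (auto simp: free_product_def fp_inj_def distinct_adj_Cons)
qed

lemma fp_cons_comp:
  assumes "\<forall>i\<in>I. group (H i)" "i \<in> I" "a \<in> carrier (H i)" "b \<in> carrier (H i)"
    and "w \<in> carrier (free_product I H)"
  shows "fp_cons H (i, a) (fp_cons H (i, b) w) = fp_cons H (i, a \<otimes>\<^bsub>H i\<^esub> b) w"
proof -
  interpret group "H i" using assms by blast
  show ?thesis
  proof (cases w)
    case Nil
    then show ?thesis using assms by (auto simp: fp_inj_def)
  next
    case (Cons x v)
    obtain j c where x: "x = (j, c)" by force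
    show ?thesis
    proof (cases "i = j")
      case False
      then show ?thesis using assms Cons x by (auto simp: fp_inj_def)
    next
      case True
      then have c: "c \<in> carrier (H i)" "c \<noteq> \<one>\<^bsub>H i\<^esub>" and v: "v = [] \<or> fst (hd v) \<noteq> i"
        using assms Cons x by (auto simp: free_product_def distinct_adj_Cons hd_map)
      have eq: "fp_cons H (i, d) v = fp_inj H i d @ v" for d
        using v by (cases v) auto
      have w: "w = (i, c) # v" using Cons x True by simp
      have assoc: "a \<otimes>\<^bsub>H i\<^esub> b \<otimes>\<^bsub>H i\<^esub> c = a \<otimes>\<^bsub>H i\<^esub> (b \<otimes>\<^bsub>H i\<^esub> c)"
        using assms(3,4) c by (simp add: m_assoc)
      show ?thesis
        using assms(3,4) c by (auto simp: w eq fp_inj_def assoc)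
    qed
  qed
qed

lemma fp_cons_one:
  assumes "\<forall>i\<in>I. group (H i)" "i \<in> I" "w \<in> carrier (free_product I H)"
  shows "fp_cons H (i, \<one>\<^bsub>H i\<^esub>) w = w"
proof -
  interpret group "H i" using assms by blast
  show ?thesis using assms(2-)
    by (cases "(H, (i, \<one>\<^bsub>H i\<^esub>), w)" rule: fp_cons.cases)
       (auto simp: free_product_def fp_inj_def)
qed

lemma fp_cons_reduced:
  assumes "x # w \<in> carrier (free_product I H)"
  shows "fp_cons H x w = x # w" "w \<in> carrier (free_product I H)"
  using assms
  by (cases x; cases w; auto simp: free_product_def fp_inj_def distinct_adj_Cons)+

lemma free_product_group:
  assumes H: "\<forall>i\<in>I. group (H i)"
  shows "group (free_product I H)"
proof -
  let ?P = "free_product I H"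
  have mult: "u \<otimes>\<^bsub>?P\<^esub> v = foldr (fp_cons H) u v" and one: "\<one>\<^bsub>?P\<^esub> = []" for u v
    by (auto simp: free_product_def)
  have mnil: "[] \<otimes>\<^bsub>?P\<^esub> v = v" and mcons: "(x # u) \<otimes>\<^bsub>?P\<^esub> v = fp_cons H x (u \<otimes>\<^bsub>?P\<^esub> v)" for x u v
    by (simp_all add: mult)
  have letter: "fst x \<in> I \<and> snd x \<in> carrier (H (fst x))" if "u \<in> carrier ?P" "x \<in> set u" for u x
    using that by (auto simp: free_product_def)
  have closed: "u \<otimes>\<^bsub>?P\<^esub> v \<in> carrier ?P" if "u \<in> carrier ?P" "v \<in> carrier ?P" for u v
    using that
  proof (induction u)
    case (Cons x u)
    then show ?case
      using fp_cons_closed[OF H, of "fst x" "snd x"] letter[of "x # u" x] fp_cons_reduced(2)[of x u I H]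
      by (simp add: mcons)
  qed (simp add: mnil)
  have step: "fp_cons H (i, a) v \<otimes>\<^bsub>?P\<^esub> w = fp_cons H (i, a) (v \<otimes>\<^bsub>?P\<^esub> w)"
    if ia: "i \<in> I" "a \<in> carrier (H i)" and v: "v \<in> carrier ?P" and w: "w \<in> carrier ?P" for i a v w
  proof -
    interpret group "H i" using H ia by blast
    have inj: "(fp_inj H i d @ u) \<otimes>\<^bsub>?P\<^esub> w = fp_cons H (i, d) (u \<otimes>\<^bsub>?P\<^esub> w)"
      if "u \<in> carrier ?P" for d u
      using fp_cons_one[OF H ia(1) closed[OF that w]] by (auto simp: fp_inj_def mcons)
    show ?thesis
    proof (cases v)
      case Nil
      then show ?thesis using inj[of "[]" a] v by (simp add: mnil)
    next
      case (Cons x u)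
      obtain j b where x: "x = (j, b)" by force
      have u: "u \<in> carrier ?P" using fp_cons_reduced(2) v Cons by blast
      have b: "b \<in> carrier (H j)" using letter[OF v, of x] Cons x by simp
      show ?thesis
        using inj[OF u] inj[OF v, of a] fp_cons_comp[OF H ia _ closed[OF u w], of b] b Cons x
        by (cases "i = j") (auto simp: mcons)
    qed
  qed
  have assoc: "u \<otimes>\<^bsub>?P\<^esub> v \<otimes>\<^bsub>?P\<^esub> w = u \<otimes>\<^bsub>?P\<^esub> (v \<otimes>\<^bsub>?P\<^esub> w)"
    if "u \<in> carrier ?P" "v \<in> carrier ?P" "w \<in> carrier ?P" for u v w
    using that
  proof (induction u)
    case (Cons x u)
    then show ?case
      using step[of "fst x" "snd x" "u \<otimes>\<^bsub>?P\<^esub> v" w] letter[of "x # u" x] fp_cons_reduced(2)[of x u I H]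
        closed[of u v]
      by (simp add: mcons)
  qed (simp add: mnil)
  have inv: "\<exists>y\<in>carrier ?P. y \<otimes>\<^bsub>?P\<^esub> x = \<one>\<^bsub>?P\<^esub>" if "x \<in> carrier ?P" for x
    using that
  proof (induction x)
    case (Cons x u)
    obtain i a where x: "x = (i, a)" by force
    have ia: "i \<in> I" "a \<in> carrier (H i)" using letter[OF Cons.prems, of x] x by auto
    interpret group "H i" using H ia by blast
    have u: "u \<in> carrier ?P" using Cons.prems fp_cons_reduced(2) by blast
    obtain y where y: "y \<in> carrier ?P" "y \<otimes>\<^bsub>?P\<^esub> u = \<one>\<^bsub>?P\<^esub>" using Cons u by blast
    let ?z = "fp_cons H (i, inv\<^bsub>H i\<^esub> a) []"
    have nil: "[] \<in> carrier ?P" by (simp add: free_product_def)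
    have z: "?z \<in> carrier ?P" using fp_cons_closed[OF H ia(1) _ nil] ia by simp
    have "?z \<otimes>\<^bsub>?P\<^esub> (x # u) = fp_cons H (i, inv\<^bsub>H i\<^esub> a) ([] \<otimes>\<^bsub>?P\<^esub> (x # u))"
      using ia nil by (intro step Cons.prems) auto
    also have "\<dots> = fp_cons H (i, inv\<^bsub>H i\<^esub> a) (fp_cons H (i, a) u)"
      using fp_cons_reduced(1)[OF Cons.prems] x by (simp add: mnil)
    also have "\<dots> = u"
      using fp_cons_comp[OF H ia(1) _ ia(2) u, of "inv\<^bsub>H i\<^esub> a"] fp_cons_one[OF H ia(1) u] ia by simp
    finally have "(y \<otimes>\<^bsub>?P\<^esub> ?z) \<otimes>\<^bsub>?P\<^esub> (x # u) = \<one>\<^bsub>?P\<^esub>"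
      using assoc[OF y(1) z Cons.prems] y by simp
    then show ?case using closed[OF y(1) z] by blast
  next
    case Nil
    have "[] \<otimes>\<^bsub>?P\<^esub> [] = \<one>\<^bsub>?P\<^esub>" by (simp add: mnil one)
    then show ?case using Nil by blast
  qed
  show ?thesis
  proof (rule groupI)
    show "\<one>\<^bsub>?P\<^esub> \<in> carrier ?P" by (simp add: free_product_def)
    show "\<one>\<^bsub>?P\<^esub> \<otimes>\<^bsub>?P\<^esub> x = x" for x by (simp add: mnil one)
  qed (fact closed assoc inv)+
qed


section \<open>Free groups\<close>

text \<open>
  Reduced words over \<open>X\<close>; the letter \<open>(x, True)\<close> stands for \<open>x\<close> and \<open>(x, False)\<close> for its inverse.
\<close>

fun fg_cons :: "'x \<times> bool \<Rightarrow> ('x \<times> bool) list \<Rightarrow> ('x \<times> bool) list" where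
  "fg_cons (x, b) [] = [(x, b)]"
| "fg_cons (x, b) ((y, c) # w) = (if x = y \<and> b \<noteq> c then w else (x, b) # (y, c) # w)"

definition free_group :: "'x set \<Rightarrow> ('x \<times> bool) list monoid" where
  "free_group X =
     \<lparr>carrier = {w. fst ` set w \<subseteq> X \<and> successively (\<lambda>(x, b) (y, c). \<not> (x = y \<and> b \<noteq> c)) w},
      monoid.mult = (\<lambda>u v. foldr fg_cons u v),
      one = []\<rparr>"

lemma fg_cons_closed:
  assumes "x \<in> X" "w \<in> carrier (free_group X)"
  shows "fg_cons (x, b) w \<in> carrier (free_group X)"
  using assms
  by (cases "((x, b), w)" rule: fg_cons.cases)
     (auto simp: free_group_def successively_Cons)

lemma fg_cons_cancel:
  assumes "w \<in> carrier (free_group X)"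
  shows "fg_cons (x, b) (fg_cons (x, \<not> b) w) = w"
  using assms
  by (cases w rule: remdups_adj.cases) (auto simp: free_group_def)

lemma fg_cons_reduced:
  assumes "x # w \<in> carrier (free_group X)"
  shows "fg_cons x w = x # w" "w \<in> carrier (free_group X)"
  using assms by (cases x; cases w; auto simp: free_group_def)+

lemma free_group_group: "group (free_group X)"
proof -
  let ?P = "free_group X"
  have mult: "u \<otimes>\<^bsub>?P\<^esub> v = foldr fg_cons u v" and one: "\<one>\<^bsub>?P\<^esub> = []" for u v
    by (auto simp: free_group_def)
  have mnil: "[] \<otimes>\<^bsub>?P\<^esub> v = v" and mcons: "(x # u) \<otimes>\<^bsub>?P\<^esub> v = fg_cons x (u \<otimes>\<^bsub>?P\<^esub> v)" for x u v
    by (simp_all add: mult)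
  have letter: "fst x \<in> X" if "u \<in> carrier ?P" "x \<in> set u" for u x
    using that by (auto simp: free_group_def)
  have closed: "u \<otimes>\<^bsub>?P\<^esub> v \<in> carrier ?P" if "u \<in> carrier ?P" "v \<in> carrier ?P" for u v
    using that
  proof (induction u)
    case (Cons x u)
    then show ?case
      using fg_cons_closed[of "fst x" X _ "snd x"] letter[of "x # u" x] fg_cons_reduced(2)[of x u X]
      by (simp add: mcons)
  qed (simp add: mnil)
  have step: "fg_cons (x, b) v \<otimes>\<^bsub>?P\<^esub> w = fg_cons (x, b) (v \<otimes>\<^bsub>?P\<^esub> w)"
    if "x \<in> X" and v: "v \<in> carrier ?P" and w: "w \<in> carrier ?P" for x b v w
  proof (cases "\<exists>u. v = (x, \<not> b) # u")
    case True
    then obtain u where u: "v = (x, \<not> b) # u" by blast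
    have "u \<in> carrier ?P" using fg_cons_reduced(2)[OF v[unfolded u]] .
    then have "fg_cons (x, b) (fg_cons (x, \<not> b) (u \<otimes>\<^bsub>?P\<^esub> w)) = u \<otimes>\<^bsub>?P\<^esub> w"
      by (rule fg_cons_cancel[OF closed[OF _ w]])
    then have "fg_cons (x, b) (v \<otimes>\<^bsub>?P\<^esub> w) = u \<otimes>\<^bsub>?P\<^esub> w"
      unfolding u mcons .
    moreover have "fg_cons (x, b) v = u" unfolding u by simp
    ultimately show ?thesis by metis
  next
    case False
    have "fg_cons (x, b) v = (x, b) # v"
    proof (cases v)
      case (Cons p u)
      obtain y c where "p = (y, c)" by force
      with Cons False have "\<not> (x = y \<and> b \<noteq> c)" by auto
      with Cons \<open>p = (y, c)\<close> show ?thesis by (simp only: fg_cons.simps if_False)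
    qed simp
    then show ?thesis using mcons by metis
  qed
  have assoc: "u \<otimes>\<^bsub>?P\<^esub> v \<otimes>\<^bsub>?P\<^esub> w = u \<otimes>\<^bsub>?P\<^esub> (v \<otimes>\<^bsub>?P\<^esub> w)"
    if "u \<in> carrier ?P" "v \<in> carrier ?P" "w \<in> carrier ?P" for u v w
    using that
  proof (induction u)
    case (Cons x u)
    then show ?case
      using step[of "fst x" "u \<otimes>\<^bsub>?P\<^esub> v" w "snd x"] letter[of "x # u" x] fg_cons_reduced(2)[of x u X]
        closed[of u v]
      by (simp add: mcons)
  qed (simp add: mnil)
  have inv: "\<exists>y\<in>carrier ?P. y \<otimes>\<^bsub>?P\<^esub> x = \<one>\<^bsub>?P\<^esub>" if "x \<in> carrier ?P" for x
    using that
  proof (induction x)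
    case (Cons p u)
    obtain x b where p: "p = (x, b)" by force
    have x: "x \<in> X" using letter[OF Cons.prems, of p] p by auto
    have u: "u \<in> carrier ?P" using Cons.prems fg_cons_reduced(2) by blast
    obtain y where y: "y \<in> carrier ?P" "y \<otimes>\<^bsub>?P\<^esub> u = \<one>\<^bsub>?P\<^esub>" using Cons u by blast
    have z: "[(x, \<not> b)] \<in> carrier ?P" using x by (simp add: free_group_def)
    have "[(x, \<not> b)] \<otimes>\<^bsub>?P\<^esub> (p # u) = u" by (simp add: mcons mnil p)
    then have "(y \<otimes>\<^bsub>?P\<^esub> [(x, \<not> b)]) \<otimes>\<^bsub>?P\<^esub> (p # u) = \<one>\<^bsub>?P\<^esub>"
      using assoc[OF y(1) z Cons.prems] y by simp
    then show ?case using closed[OF y(1) z] by blast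
  next
    case Nil
    have "[] \<otimes>\<^bsub>?P\<^esub> [] = \<one>\<^bsub>?P\<^esub>" by (simp add: mnil one)
    then show ?case using Nil by blast
  qed
  show ?thesis
  proof (rule groupI)
    show "\<one>\<^bsub>?P\<^esub> \<in> carrier ?P" by (simp add: free_group_def)
    show "\<one>\<^bsub>?P\<^esub> \<otimes>\<^bsub>?P\<^esub> x = x" for x by (simp add: mnil one)
  qed (fact closed assoc inv)+
qed

definition free_basis :: "('a, 'c) monoid_scheme \<Rightarrow> 'a set \<Rightarrow> bool" where
  "free_basis F B \<longleftrightarrow> (\<exists>\<psi> \<in> iso (free_group B) F. \<forall>b\<in>B. \<psi> [(b, True)] = b)"


section \<open>Plain groups and standard generating sets\<close>

definition generating_set :: "('a, 'c) monoid_scheme \<Rightarrow> 'a set \<Rightarrow> bool" where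
  "generating_set G S \<longleftrightarrow>
     finite S \<and> S \<subseteq> carrier G \<and> \<one>\<^bsub>G\<^esub> \<notin> S \<and> (\<forall>s\<in>S. inv\<^bsub>G\<^esub> s \<in> S) \<and> generate G S = carrier G"

text \<open>
  The factors are indexed by \<open>0, \<dots>, k\<close>: the finite groups \<open>G\<^sub>1, \<dots>, G\<^sub>k\<close> have the indices \<open>i < k\<close>, the
  free group of rank \<open>m\<close> has index \<open>k\<close>.  All factors of a free product share one element type.
  Since the type of words over \<open>nat\<close> is infinite, every finite group is isomorphic to one carried
  by this type, so taking the \<open>G\<^sub>i\<close> there is no restriction.
\<close>

definition plain_factors ::
  "nat \<Rightarrow> nat \<Rightarrow> (nat \<Rightarrow> (nat \<times> bool) list monoid) \<Rightarrow> nat \<Rightarrow> (nat \<times> bool) list monoid" where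
  "plain_factors k m H i = (if i < k then H i else free_group {..<m})"

definition plain_decomposition ::
  "('a, 'c) monoid_scheme \<Rightarrow> nat \<Rightarrow> nat \<Rightarrow> (nat \<Rightarrow> (nat \<times> bool) list monoid) \<Rightarrow>
    ((nat \<times> (nat \<times> bool) list) list \<Rightarrow> 'a) \<Rightarrow> bool" where
  "plain_decomposition G k m H \<phi> \<longleftrightarrow>
     (\<forall>i<k. group (H i) \<and> finite (carrier (H i))) \<and>
     \<phi> \<in> iso (free_product {..k} (plain_factors k m H)) G"

definition plain_group :: "('a, 'c) monoid_scheme \<Rightarrow> bool" where
  "plain_group G \<longleftrightarrow> group G \<and> (\<exists>k m H \<phi>. plain_decomposition G k m H \<phi>)"

text \<open>
  \<open>T i\<close> is the part of the generating set lying in the \<open>i\<close>-th factor, before the identification of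
  that factor with a subgroup of \<open>G\<close> via \<open>\<phi>\<close>.
\<close>

definition standard_generating_set :: "('a, 'c) monoid_scheme \<Rightarrow> 'a set \<Rightarrow> bool" where
  "standard_generating_set G S \<longleftrightarrow>
     generating_set G S \<and>
     (\<exists>k m H \<phi> T.
        plain_decomposition G k m H \<phi> \<and>
        (\<forall>i<k. generating_set (H i) (T i)) \<and>
        (\<exists>B. free_basis (free_group {..<m}) B \<and> T k = B \<union> m_inv (free_group {..<m}) ` B) \<and>
        (let S' = (\<lambda>i. (\<lambda>t. \<phi> (fp_inj (plain_factors k m H) i t)) ` T i) in
           S = (\<Union>i\<le>k. S' i) \<and> disjoint_family_on S' {..k}))"


section \<open>The connective constant of a Cayley graph\<close>

text \<open>
  The undirected edge between \<open>g\<close> and \<open>g s\<close> is represented by its two orientations; both are present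
  because \<open>S\<close> is symmetric.
\<close>

definition cayley_graph :: "('a, 'c) monoid_scheme \<Rightarrow> 'a set \<Rightarrow> 'a pair_pre_digraph" where
  "cayley_graph G S =
     \<lparr>pverts = carrier G, parcs = {(g, g \<otimes>\<^bsub>G\<^esub> s) | g s. g \<in> carrier G \<and> s \<in> S}\<rparr>"

text \<open>\<^const>\<open>pre_digraph.apath\<close> is the library's notion of a walk without repeated vertices.\<close>

definition saw_count :: "('a, 'c) monoid_scheme \<Rightarrow> 'a set \<Rightarrow> nat \<Rightarrow> nat" where
  "saw_count G S n =
     card {p. length p = n \<and> (\<exists>v. pre_digraph.apath (with_proj (cayley_graph G S)) \<one>\<^bsub>G\<^esub> p v)}"

definition connective_constant :: "('a, 'c) monoid_scheme \<Rightarrow> 'a set \<Rightarrow> real" where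
  "connective_constant G S = lim (\<lambda>n. root n (real (saw_count G S n)))"


section \<open>Perron numbers\<close>

text \<open>Algebraic conjugates: roots of the same minimal polynomial over the rationals.\<close>

definition conjugate_of :: "complex \<Rightarrow> complex \<Rightarrow> bool" where
  "conjugate_of x z \<longleftrightarrow>
     (\<exists>p :: rat poly. irreducible p \<and> lead_coeff p = 1 \<and>
        poly (map_poly of_rat p) x = 0 \<and> poly (map_poly of_rat p) z = 0)"

definition perron_number :: "real \<Rightarrow> bool" where
  "perron_number l \<longleftrightarrow>
     algebraic_int l \<and> l \<ge> 1 \<and>
     (\<forall>z. conjugate_of (complex_of_real l) z \<and> z \<noteq> complex_of_real l \<longrightarrow> cmod z < l)"

end

theory Submission
  imports Defs "HOL-Library.Sublist" "HOL-Computational_Algebra.Field_as_Ring"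
    "Jordan_Normal_Form.Char_Poly"
begin

text \<open>
  A walk from the identity is given by its word of steps, and it is self-avoiding iff no nonempty
  subword is trivial.  In a free product with a standard generating set this may be tested
  separately on each maximal block of letters from one factor.  Hence the self-avoiding words,
  grown by prepending letters, are the paths of a finite graph whose vertices record the first block
  (only its first letter for the free factor, where a word is self-avoiding iff it is reduced).
  The adjacency matrix of this graph has an explicit positive eigenvector, built from the generating
  polynomials of the self-avoiding walks in the finite factors, so its eigenvalue is the connective
  constant.  Unless there are only two letters (and the constant is 1) the graph is strongly
  connected and aperiodic, so the eigenvalue exceeds the moduli of all other eigenvalues, among them
  its conjugates.  The exponent can therefore be taken to be 1.
\<close>

section \<open>A Perron-Frobenius criterion\<close>

text \<open>The eigenvector is read off from generating functions in a variable x that marks length.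
  Let F count all self-avoiding words and E_i those of factor i. Words whose last block lies in
  factor i are counted by (E_i - 1) F / E_i, so F = 1 + F * sum_i (1 - 1/E_i). The growth rate is
  therefore 1/x for the x at which this sum reaches 1. If E_i(u) counts the words that extend a
  block u within its factor, then F * E_i(u) / E_i counts the words that can be put in front of the
  state (i, u), and the quotient E_i(u) / E_i is the eigenvector. In the free factor, E = E(s) + x
  E(s^-1), and E(s) = E(s^-1) by symmetry, so the quotient is 1/(1+x). The series only motivate the
  formulas: the eigenvector equation is checked by direct computation, so no convergence question
  arises. Positivity of the eigenvector also yields the existence of the limit that defines the
  connective constant.\<close>

interpretation of_rat_poly_hom: map_poly_inj_idom_hom of_rat ..

text \<open>If the two were coprime, a Bezout combination equal to 1 would vanish at
  \<open>z\<close>. This makes every conjugate of an eigenvalue a root of the characteristic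
  polynomial.\<close>

lemma irreducible_dvd_of_common_root:
  fixes p c :: "rat poly" and z :: "'a :: field_char_0"
  assumes irr: "irreducible p" and p: "poly (map_poly of_rat p) z = 0"
    and c: "poly (map_poly of_rat c) z = 0"
  shows "p dvd c"
proof (rule ccontr)
  assume "\<not> p dvd c"
  then have "coprime p c"
    using irr by (intro prime_elem_imp_coprime field_poly_irreducible_imp_prime)
  then obtain a b where ab: "a * p + b * c = 1"
    by (metis bezout_coefficients_fst_snd coprime_iff_gcd_eq_1)
  have "poly (map_poly of_rat (a * p + b * c)) z = 0"
    using p c by (simp add: of_rat_poly_hom.hom_mult of_rat_poly_hom.hom_add)
  then show False by (simp add: ab)
qed

text \<open>Integer entries give a monic integer characteristic polynomial. It shows that a real
  eigenvalue is an algebraic integer and can still be evaluated at complex conjugates.\<close>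

lemma int_char_poly_eigenvalue:
  fixes A :: "int mat"
  assumes A: "A \<in> carrier_mat n n" and n: "\<And>i. i < n \<Longrightarrow> (\<Sum>j<n. of_int (A $$ (i, j)) * f j) = z * f i"
    and f: "i0 < n" "f i0 \<noteq> 0"
  shows "poly (map_poly of_int (char_poly A)) (z :: 'a :: field_char_0) = 0"
proof -
  let ?B = "map_mat of_int A :: 'a mat"
  have B: "?B \<in> carrier_mat n n" using A by simp
  have "eigenvector ?B (vec n f) z"
    unfolding eigenvector_def
  proof (intro conjI)
    show "vec n f \<in> carrier_vec (dim_row ?B)" using A by simp
    show "vec n f \<noteq> 0\<^sub>v (dim_row ?B)" using A f by (metis carrier_matD(1) index_map_mat(2) index_vec index_zero_vec(1))
    show "?B *\<^sub>v vec n f = z \<cdot>\<^sub>v vec n f"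
      using A n by (intro eq_vecI) (auto simp: scalar_prod_def atLeast0LessThan)
  qed
  then have "poly (char_poly ?B) z = 0"
    using eigenvalue_root_char_poly[OF B] by (auto simp: eigenvalue_def)
  then show ?thesis by (simp add: of_int_hom.char_poly_hom[OF A])
qed

lemma int_char_poly_eigenvector:
  fixes A :: "int mat" and z :: "'a :: field_char_0"
  assumes A: "A \<in> carrier_mat n n" and z: "poly (map_poly of_int (char_poly A)) z = 0"
  obtains f where "\<And>i. i < n \<Longrightarrow> (\<Sum>j<n. of_int (A $$ (i, j)) * f j) = z * f i" "\<exists>i<n. f i \<noteq> 0"
proof -
  let ?B = "map_mat of_int A :: 'a mat"
  have B: "?B \<in> carrier_mat n n" using A by simp
  have "eigenvalue ?B z"
    using z eigenvalue_root_char_poly[OF B] by (simp add: of_int_hom.char_poly_hom[OF A])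
  then obtain v where v: "v \<in> carrier_vec n" "v \<noteq> 0\<^sub>v n" "?B *\<^sub>v v = z \<cdot>\<^sub>v v"
    using A by (auto simp: eigenvalue_def eigenvector_def)
  show ?thesis
  proof (rule that[of "\<lambda>i. v $ i"])
    fix i assume i: "i < n"
    have "(?B *\<^sub>v v) $ i = z * v $ i" using v i by simp
    then show "(\<Sum>j<n. of_int (A $$ (i, j)) * v $ j) = z * v $ i"
      using A v(1) i by (simp add: scalar_prod_def atLeast0LessThan)
  next
    show "\<exists>i<n. v $ i \<noteq> 0"
      using v by (metis carrier_vecD eq_vecI index_zero_vec)
  qed
qed

text \<open>
  An eigenvector of a conjugate of \<open>l\<close> is dominated by the positive eigenvector \<open>h\<close> of \<open>l\<close>; equality
  of moduli spreads along edges and forces the phase to rotate by the fixed angle \<open>z / l\<close>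
  at each step.
\<close>

lemma dominated_eigenvector_rotates:
  fixes h :: "'q \<Rightarrow> real" and f :: "'q \<Rightarrow> complex"
  assumes Q: "finite Q" and EQ: "\<And>q. q \<in> Q \<Longrightarrow> E q \<subseteq> Q"
    and h: "\<And>q. q \<in> Q \<Longrightarrow> h q > 0" and hl: "\<And>q. q \<in> Q \<Longrightarrow> (\<Sum>r\<in>E q. h r) = l * h q"
    and l: "l > 0"
    and fz: "\<And>q. q \<in> Q \<Longrightarrow> (\<Sum>r\<in>E q. f r) = z * f q" and f: "q0 \<in> Q" "f q0 \<noteq> 0"
    and conn: "\<And>q r. q \<in> Q \<Longrightarrow> r \<in> Q \<Longrightarrow> (q, r) \<in> {(q, r). q \<in> Q \<and> r \<in> E q}\<^sup>*"
    and zl: "cmod z \<ge> l"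
  obtains "cmod z = l" "\<And>q r. q \<in> Q \<Longrightarrow> r \<in> E q \<Longrightarrow> f r / h r = (z / l) * (f q / h q)"
    "\<And>q. q \<in> Q \<Longrightarrow> f q \<noteq> 0"
proof -
  \<comment> \<open>\<open>C * h\<close> is the least multiple of \<open>h\<close> that dominates
    the moduli of \<open>f\<close>; a vertex where the bound is attained starts the
    propagation.\<close>
  define C where "C = Max ((\<lambda>q. cmod (f q) / h q) ` Q)"
  have fin: "finite (E q)" if "q \<in> Q" for q using EQ[OF that] Q finite_subset by blast
  have C: "cmod (f q) \<le> C * h q" if "q \<in> Q" for q
  proof -
    have "cmod (f q) / h q \<le> C" unfolding C_def using that Q by (intro Max_ge) auto
    then show ?thesis using h[OF that] by (simp add: field_simps)
  qed
  have C0: "C > 0"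
    using C[OF f(1)] h[OF f(1)] f(2) by (metis less_le_trans zero_less_mult_pos2 zero_less_norm_iff)
  have "C \<in> (\<lambda>q. cmod (f q) / h q) ` Q"
    unfolding C_def using Q f by (intro Max_in) auto
  then obtain q1 where q1: "q1 \<in> Q" "cmod (f q1) = C * h q1" using h by force
  \<comment> \<open>At such a vertex the triangle inequality is an equality, so every
    \<open>f r\<close> has maximal modulus and points in the direction of
    \<open>z * f q\<close>.\<close>
  have key: "cmod z = l \<and> (\<forall>r\<in>E q. cmod (f r) = C * h r \<and> f r / h r = (z / l) * (f q / h q))"
    if q: "q \<in> Q" "cmod (f q) = C * h q" for q
  proof -
    have "cmod z * (C * h q) = cmod (\<Sum>r\<in>E q. f r)" using fz[OF q(1)] q by (simp add: norm_mult)
    also have "\<dots> \<le> (\<Sum>r\<in>E q. cmod (f r))" by (rule norm_sum)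
    also have "\<dots> \<le> (\<Sum>r\<in>E q. C * h r)" using C EQ q by (intro sum_mono) auto
    also have "\<dots> = l * (C * h q)" using hl[OF q(1)] by (simp add: sum_distrib_left[symmetric])
    finally have "cmod z \<le> l" using C0 h[OF q(1)] by simp
    then have zl': "cmod z = l" using zl by simp
    define y where "y = z * f q"
    have y: "cmod y = l * C * h q" using zl' q by (simp add: y_def norm_mult)
    then have y0: "cmod y > 0" using l C0 h[OF q(1)] by simp
    have ineq: "Re (f r * cnj y) \<le> C * h r * cmod y" if "r \<in> E q" for r
    proof -
      have "Re (f r * cnj y) \<le> cmod (f r) * cmod y"
        using complex_Re_le_cmod[of "f r * cnj y"] by (simp add: norm_mult)
      also have "\<dots> \<le> C * h r * cmod y" using C EQ q that by (intro mult_right_mono) auto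
      finally show ?thesis .
    qed
    \<comment> \<open>The summands are nonnegative with sum zero, so each real part attains its
      bound.\<close>
    have "(\<Sum>r\<in>E q. C * h r * cmod y - Re (f r * cnj y)) = 0"
    proof -
      have "(\<Sum>r\<in>E q. Re (f r * cnj y)) = Re ((\<Sum>r\<in>E q. f r) * cnj y)"
        by (simp add: sum_distrib_right Re_sum)
      also have "\<dots> = (cmod y)\<^sup>2" using fz[OF q(1)] by (simp add: y_def[symmetric] complex_mult_cnj cmod_def)
      finally have "(\<Sum>r\<in>E q. Re (f r * cnj y)) = (cmod y)\<^sup>2" .
      moreover have "(\<Sum>r\<in>E q. C * h r * cmod y) = C * (\<Sum>r\<in>E q. h r) * cmod y"
        by (simp add: sum_distrib_left sum_distrib_right)
      ultimately show ?thesis using y hl[OF q(1)] by (simp add: sum_subtractf power2_eq_square)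
    qed
    then have eq: "C * h r * cmod y = Re (f r * cnj y)" if "r \<in> E q" for r
      using ineq that fin[OF q(1)] by (subst (asm) sum_nonneg_eq_0_iff) (auto simp del: complex_cnj_mult)
    have "cmod (f r) = C * h r \<and> f r / h r = (z / l) * (f q / h q)" if r: "r \<in> E q" for r
    proof -
      have rQ: "r \<in> Q" using EQ q r by blast
      have hr: "h r > 0" "h q > 0" using h rQ q by auto
      have "C * h r * cmod y \<le> cmod (f r) * cmod y"
        using eq[OF r] complex_Re_le_cmod[of "f r * cnj y"] by (simp add: norm_mult)
      then have 1: "cmod (f r) = C * h r" using y0 C[OF rQ] by simp
      have K: "Re (f r * cnj y) = cmod (f r * cnj y)" using eq[OF r] 1 by (simp add: norm_mult)
      then have "Im (f r * cnj y) = 0" using cmod_power2[of "f r * cnj y"] by simp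
      then have "f r * cnj y = of_real (C * h r * cmod y)"
        using eq[OF r] by (simp add: complex_eq_iff del: complex_cnj_mult times_complex.sel)
      then have "f r * (cnj y * y) = of_real (C * h r * cmod y) * y" by (simp add: mult.assoc[symmetric])
      then have "f r * of_real (cmod y) = of_real (C * h r) * y"
        using y0 by (simp add: complex_norm_square[symmetric] mult.commute[of "cnj y"] power2_eq_square)
      then have "f r * of_real (l * h q) = of_real (h r) * (z * f q)"
        using C0 by (simp add: y y_def[symmetric])
      then have "f r / h r = (z / l) * (f q / h q)"
        using hr l by (simp add: field_simps)
      then show ?thesis using 1 by blast
    qed
    then show ?thesis using zl' by blast
  qed
  have all: "cmod (f r) = C * h r" if "r \<in> Q" for r
    using conn[OF q1(1) that] q1(2)
    by (induction rule: rtrancl_induct) (use key in auto)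
  show ?thesis
  proof (rule that)
    show "f q \<noteq> 0" if "q \<in> Q" for q using all[OF that] C0 h[OF that] by auto
  qed (use key all q1 in blast)+
qed


text \<open>Closed walks of consecutive lengths at one vertex encode aperiodicity. A conjugate of
  modulus at least \<open>l\<close> has an eigenvector that turns by \<open>z / l\<close> along each
  edge, so \<open>(z / l) ^ n\<close> and \<open>(z / l) ^ Suc n\<close> are both 1, whence
  \<open>z = l\<close>.\<close>

theorem positive_eigenvalue_perron:
  fixes h :: "'q \<Rightarrow> real"
  assumes Q: "finite Q" and EQ: "\<And>q. q \<in> Q \<Longrightarrow> E q \<subseteq> Q"
    and h: "\<And>q. q \<in> Q \<Longrightarrow> h q > 0" and hl: "\<And>q. q \<in> Q \<Longrightarrow> (\<Sum>r\<in>E q. h r) = l * h q"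
    and l: "l \<ge> 1"
    and conn: "\<And>q r. q \<in> Q \<Longrightarrow> r \<in> Q \<Longrightarrow> (q, r) \<in> {(q, r). q \<in> Q \<and> r \<in> E q}\<^sup>*"
    and loops: "q0 \<in> Q" "(q0, q0) \<in> {(q, r). q \<in> Q \<and> r \<in> E q} ^^ n"
      "(q0, q0) \<in> {(q, r). q \<in> Q \<and> r \<in> E q} ^^ Suc n"
  shows "perron_number l"
proof -
  define N where "N = card Q"
  obtain e where e: "bij_betw e {..<N} Q"
    using ex_bij_betw_nat_finite[OF Q] by (auto simp: N_def atLeast0LessThan)
  define A :: "int mat" where "A = mat N N (\<lambda>(i, j). if e j \<in> E (e i) then 1 else 0)"
  have A: "A \<in> carrier_mat N N" by (simp add: A_def)
  have eQ: "e i \<in> Q" if "i < N" for i using e that by (auto simp: bij_betw_def)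
  have sumA: "(\<Sum>j<N. of_int (A $$ (i, j)) * f (e j)) = (\<Sum>r\<in>E (e i). f r)" if i: "i < N"
    for f :: "'q \<Rightarrow> 'c :: field_char_0" and i
  proof -
    have "(\<Sum>j<N. of_int (A $$ (i, j)) * f (e j)) = (\<Sum>j<N. if e j \<in> E (e i) then f (e j) else 0)"
      using i by (intro sum.cong) (auto simp: A_def)
    also have "\<dots> = (\<Sum>r\<in>Q. if r \<in> E (e i) then f r else 0)"
      by (rule sum.reindex_bij_betw[OF e])
    also have "\<dots> = (\<Sum>r\<in>E (e i). f r)"
      using EQ[OF eQ[OF i]] Q by (simp add: sum.inter_restrict[symmetric] Int_absorb1)
    finally show ?thesis .
  qed
  obtain i0 where i0: "i0 < N" "e i0 = q0" using e loops(1) by (auto simp: bij_betw_def image_iff)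
  define c where "c = char_poly A"
  have cl: "poly (map_poly of_int c) l = 0"
    unfolding c_def
  proof (rule int_char_poly_eigenvalue[OF A, of "\<lambda>i. h (e i)"])
    show "(\<Sum>j<N. of_int (A $$ (i, j)) * h (e j)) = l * h (e i)" if "i < N" for i
      using sumA[OF that, of h] hl[OF eQ[OF that]] by simp
    show "i0 < N" by (fact i0)
    show "h (e i0) \<noteq> 0" using h[OF loops(1)] i0 by simp
  qed
  have monic: "lead_coeff c = 1" using degree_monic_char_poly[OF A] by (simp add: c_def)
  have "algebraic_int l"
    using cl monic by (intro algebraic_int.intros[of "map_poly of_int c"]) auto
  moreover have "cmod z < l" if conj: "conjugate_of l z" and zl: "z \<noteq> l" for z
  proof (rule ccontr)
    assume "\<not> cmod z < l"
    then have zl': "cmod z \<ge> l" by simp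
    obtain p :: "rat poly" where p: "irreducible p" "poly (map_poly of_rat p) (complex_of_real l) = 0"
      "poly (map_poly of_rat p) z = 0"
      using conj by (auto simp: conjugate_of_def)
    define cq where "cq = (map_poly of_int c :: rat poly)"
    have cq: "map_poly of_rat cq = (map_poly of_int c :: complex poly)"
      by (simp add: cq_def map_poly_map_poly o_def)
    have "poly (map_poly of_int c) (complex_of_real l) = 0"
    proof -
      have "map_poly of_int c = map_poly complex_of_real (map_poly of_int c)"
        by (simp add: map_poly_map_poly o_def)
      then show ?thesis using cl by simp
    qed
    then have "p dvd cq" using irreducible_dvd_of_common_root[OF p(1,2)] cq by simp
    then have "poly (map_poly of_int c) z = 0"
      unfolding cq[symmetric] using p(3) by (auto simp: of_rat_poly_hom.hom_mult elim!: dvdE)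
    then obtain g where g: "\<And>i. i < N \<Longrightarrow> (\<Sum>j<N. of_int (A $$ (i, j)) * g j) = z * g i"
      and g0: "\<exists>i<N. g i \<noteq> 0"
      using int_char_poly_eigenvector[OF A, of z] unfolding c_def by blast
    define f where "f = (\<lambda>q. g (the_inv_into {..<N} e q))"
    have fe: "f (e i) = g i" if "i < N" for i
      using e that by (simp add: f_def bij_betw_def the_inv_into_f_f)
    have fz: "(\<Sum>r\<in>E q. f r) = z * f q" if "q \<in> Q" for q
    proof -
      obtain i where i: "i < N" "q = e i"
        using e \<open>q \<in> Q\<close> unfolding bij_betw_def by (metis imageE lessThan_iff)
      have "(\<Sum>j<N. of_int (A $$ (i, j)) * f (e j)) = z * f (e i)" using g[OF i(1)] i fe by simp
      then show ?thesis using sumA[OF i(1), of f] i by simp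
    qed
    obtain i1 where i1: "i1 < N" "g i1 \<noteq> 0" using g0 by blast
    have f1: "e i1 \<in> Q" "f (e i1) \<noteq> 0" using i1 fe eQ by auto
    have l0: "l > 0" using l by simp
    obtain *: "cmod z = l" "\<And>q r. q \<in> Q \<Longrightarrow> r \<in> E q \<Longrightarrow> f r / h r = (z / l) * (f q / h q)"
      "\<And>q. q \<in> Q \<Longrightarrow> f q \<noteq> 0"
      using dominated_eigenvector_rotates[OF Q EQ h hl l0 fz f1 conn zl'] by blast
    have walk: "f r / h r = (z / l) ^ m * (f q / h q)"
      if "(q, r) \<in> {(q, r). q \<in> Q \<and> r \<in> E q} ^^ m" for q r m
      using that
    proof (induction m arbitrary: r)
      case (Suc m)
      then obtain s where s: "(q, s) \<in> {(q, r). q \<in> Q \<and> r \<in> E q} ^^ m" "s \<in> Q" "r \<in> E s" by auto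
      show ?case using Suc.IH[OF s(1)] *(2)[OF s(2,3)] by simp
    qed auto
    have nz: "f q0 / h q0 \<noteq> 0" using *(3)[OF loops(1)] h[OF loops(1)] by simp
    have "(z / l) ^ n = 1" "(z / l) ^ Suc n = 1"
      using walk[OF loops(2)] walk[OF loops(3)] nz by (metis mult_cancel_right1)+
    then have "z / l = 1" by simp
    then show False using zl l0 by (simp add: field_simps)
  qed
  ultimately show ?thesis using l by (auto simp: perron_number_def)
qed

text \<open>The witness is one vertex with a loop, whose closed walks of lengths 0 and 1 are
  consecutive.\<close>

lemma perron_number_one: "perron_number 1"
proof (rule positive_eigenvalue_perron[of "{()}" "\<lambda>_. {()}" "\<lambda>_. 1" 1 "()" 0])
qed auto

section \<open>Self-avoiding words\<close>

text \<open>\<open>saw K w\<close>: the walk with step sequence \<open>w\<close> in a Cayley graph of \<open>K\<close> is self-avoiding.\<close>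

definition word_prod :: "('a, 'c) monoid_scheme \<Rightarrow> 'a list \<Rightarrow> 'a" where
  "word_prod K w = foldr (\<otimes>\<^bsub>K\<^esub>) w \<one>\<^bsub>K\<^esub>"

primrec saw :: "('a, 'c) monoid_scheme \<Rightarrow> 'a list \<Rightarrow> bool" where
  "saw K [] \<longleftrightarrow> True"
| "saw K (s # w) \<longleftrightarrow> (\<forall>u. prefix u w \<longrightarrow> word_prod K (s # u) \<noteq> \<one>\<^bsub>K\<^esub>) \<and> saw K w"

lemma word_prod_Nil [simp]: "word_prod K [] = \<one>\<^bsub>K\<^esub>"
  and word_prod_Cons [simp]: "word_prod K (s # w) = s \<otimes>\<^bsub>K\<^esub> word_prod K w"
  by (simp_all add: word_prod_def)

lemma saw_appendD: "saw K (u @ w) \<Longrightarrow> saw K w"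
  by (induction u) auto

lemma saw_prefix: "saw K w \<Longrightarrow> prefix u w \<Longrightarrow> saw K u"
proof (induction w arbitrary: u)
  case (Cons s w)
  show ?case
  proof (cases u)
    case (Cons t v)
    then show ?thesis using Cons.IH[of v] Cons.prems prefix_order.trans by auto
  qed simp
qed simp

section \<open>Words of steps and paths in the Cayley graph\<close>

primrec walk_verts :: "('a, 'c) monoid_scheme \<Rightarrow> 'a \<Rightarrow> 'a list \<Rightarrow> 'a list" where
  "walk_verts K g [] = [g]"
| "walk_verts K g (s # w) = g # walk_verts K (g \<otimes>\<^bsub>K\<^esub> s) w"

primrec walk_arcs :: "('a, 'c) monoid_scheme \<Rightarrow> 'a \<Rightarrow> 'a list \<Rightarrow> ('a \<times> 'a) list" where
  "walk_arcs K g [] = []"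
| "walk_arcs K g (s # w) = (g, g \<otimes>\<^bsub>K\<^esub> s) # walk_arcs K (g \<otimes>\<^bsub>K\<^esub> s) w"

lemma length_walk_verts [simp]: "length (walk_verts K g w) = Suc (length w)"
  and length_walk_arcs [simp]: "length (walk_arcs K g w) = length w"
  by (induction w arbitrary: g) auto

context group
begin

lemma word_prod_closed [intro, simp]: "set w \<subseteq> carrier G \<Longrightarrow> word_prod G w \<in> carrier G"
  by (induction w) auto

lemma set_walk_verts:
  "g \<in> carrier G \<Longrightarrow> set w \<subseteq> carrier G \<Longrightarrow>
    set (walk_verts G g w) = (\<lambda>u. g \<otimes> word_prod G u) ` {u. prefix u w}"
proof (induction w arbitrary: g)
  case (Cons s w)
  have *: "{u. prefix u (s # w)} = insert [] ((#) s ` {u. prefix u w})"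
    by (auto simp: prefix_Cons)
  have "g \<otimes> s \<otimes> word_prod G u = g \<otimes> (s \<otimes> word_prod G u)" if "prefix u w" for u
    using Cons.prems that by (subst m_assoc) (auto dest!: set_mono_prefix)
  then show ?case using Cons by (simp add: * image_image)
qed auto

text \<open>A walk meets its first vertex again exactly when some nonempty prefix has trivial
  product, since \<open>g\<close> cancels on the left. The base point is arbitrary because the tail
  starts at \<open>g \<otimes> s\<close>.\<close>

lemma distinct_walk_verts:
  "g \<in> carrier G \<Longrightarrow> set w \<subseteq> carrier G \<Longrightarrow> distinct (walk_verts G g w) \<longleftrightarrow> saw G w"
proof (induction w arbitrary: g)
  case (Cons s w)
  have s: "s \<in> carrier G" "set w \<subseteq> carrier G" using Cons.prems by auto
  have "g = g \<otimes> s \<otimes> word_prod G u \<longleftrightarrow> s \<otimes> word_prod G u = \<one>" if "prefix u w" for u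
  proof -
    have u: "word_prod G u \<in> carrier G" using set_mono_prefix[OF that] s by auto
    then have "g \<otimes> s \<otimes> word_prod G u = g \<otimes> (s \<otimes> word_prod G u)"
      using s Cons.prems by (intro m_assoc) auto
    then show ?thesis using s u Cons.prems by (simp add: l_cancel_one')
  qed
  then have "g \<in> set (walk_verts G (g \<otimes> s) w) \<longleftrightarrow> (\<exists>u. prefix u w \<and> s \<otimes> word_prod G u = \<one>)"
    using s Cons.prems by (auto simp: set_walk_verts)
  then show ?case using Cons s by auto
qed simp

text \<open>The walk visits \<open>length w + 1\<close> distinct elements. Hence a finite factor
  with finitely many letters has only finitely many self-avoiding words, which keeps the graph of
  states finite.\<close>

lemma saw_length_less:
  assumes "finite (carrier G)" "set w \<subseteq> carrier G" "saw G w"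
  shows "length w < card (carrier G)"
proof -
  have "set (walk_verts G \<one> w) \<subseteq> carrier G"
    using assms by (auto simp: set_walk_verts dest!: set_mono_prefix)
  then have "card (set (walk_verts G \<one> w)) \<le> card (carrier G)"
    by (rule card_mono[OF assms(1)])
  then show ?thesis
    using assms by (simp add: distinct_card distinct_walk_verts)
qed

lemma walk_arcs_apath:
  fixes S defines "\<Gamma> \<equiv> with_proj (cayley_graph G S)"
  assumes S: "S \<subseteq> carrier G" and g: "g \<in> carrier G" and w: "set w \<subseteq> S"
  shows "\<exists>v. pre_digraph.awalk \<Gamma> g (walk_arcs G g w) v"
    and "pre_digraph.awalk_verts \<Gamma> g (walk_arcs G g w) = walk_verts G g w"
proof -
  show "\<exists>v. pre_digraph.awalk \<Gamma> g (walk_arcs G g w) v"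
    using g w
  proof (induction w arbitrary: g)
    case (Cons s w)
    then have "g \<otimes> s \<in> carrier G" "set w \<subseteq> S" using S by auto
    then obtain v where "pre_digraph.awalk \<Gamma> (g \<otimes> s) (walk_arcs G (g \<otimes> s) w) v"
      using Cons.IH by blast
    then have "pre_digraph.awalk \<Gamma> g (walk_arcs G g (s # w)) v"
      using Cons.prems by (auto simp: \<Gamma>_def pre_digraph.awalk_def pre_digraph.cas.simps cayley_graph_def)
    then show ?case by blast
  qed (auto simp: \<Gamma>_def pre_digraph.awalk_def pre_digraph.cas.simps cayley_graph_def)
  show "pre_digraph.awalk_verts \<Gamma> g (walk_arcs G g w) = walk_verts G g w"
    by (induction w arbitrary: g) (auto simp: \<Gamma>_def pre_digraph.awalk_verts.simps)
qed

lemma awalk_is_walk_arcs: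
  assumes S: "S \<subseteq> carrier G"
    and p: "pre_digraph.awalk (with_proj (cayley_graph G S)) g p v"
  shows "\<exists>w. set w \<subseteq> S \<and> p = walk_arcs G g w"
  using p
proof (induction p arbitrary: g)
  case Nil
  show ?case by (intro exI[of _ "[]"]) auto
next
  case (Cons a p)
  then obtain s where s: "s \<in> S" "a = (g, g \<otimes> s)" "g \<in> carrier G"
    by (auto simp: pre_digraph.awalk_def pre_digraph.cas.simps cayley_graph_def)
  have "pre_digraph.awalk (with_proj (cayley_graph G S)) (g \<otimes> s) p v"
    using Cons.prems S s
    by (auto simp: pre_digraph.awalk_def pre_digraph.cas.simps cayley_graph_def)
  then obtain w where "set w \<subseteq> S" "p = walk_arcs G (g \<otimes> s) w" using Cons.IH by blast
  then show ?case using s by (intro exI[of _ "s # w"]) auto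
qed

lemma walk_arcs_inj:
  "g \<in> carrier G \<Longrightarrow> set w \<subseteq> carrier G \<Longrightarrow> set w' \<subseteq> carrier G \<Longrightarrow>
    walk_arcs G g w = walk_arcs G g w' \<Longrightarrow> w = w'"
proof (induction w arbitrary: g w')
  case Nil
  then show ?case by (cases w') auto
next
  case (Cons s w)
  then show ?case by (cases w') auto
qed

lemma saw_count_eq:
  assumes S: "S \<subseteq> carrier G"
  shows "saw_count G S n = card {w. length w = n \<and> set w \<subseteq> S \<and> saw G w}"
proof -
  let ?W = "{w. length w = n \<and> set w \<subseteq> S \<and> saw G w}"
  have "{p. length p = n \<and> (\<exists>v. pre_digraph.apath (with_proj (cayley_graph G S)) \<one> p v)}
      = walk_arcs G \<one> ` ?W"
  proof (intro equalityI subsetI)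
    fix p assume "p \<in> {p. length p = n \<and> (\<exists>v. pre_digraph.apath (with_proj (cayley_graph G S)) \<one> p v)}"
    then obtain v where p: "length p = n" "pre_digraph.apath (with_proj (cayley_graph G S)) \<one> p v"
      by blast
    then obtain w where w: "set w \<subseteq> S" "p = walk_arcs G \<one> w"
      using awalk_is_walk_arcs[OF S] by (metis pre_digraph.apath_def)
    moreover have "saw G w"
      using p w walk_arcs_apath(2)[OF S one_closed w(1)] distinct_walk_verts[OF one_closed, of w] S
      by (auto simp: pre_digraph.apath_def)
    ultimately show "p \<in> walk_arcs G \<one> ` ?W" using p by auto
  next
    fix p assume "p \<in> walk_arcs G \<one> ` ?W"
    then obtain w where w: "length w = n" "set w \<subseteq> S" "saw G w" "p = walk_arcs G \<one> w" by blast
    then show "p \<in> {p. length p = n \<and> (\<exists>v. pre_digraph.apath (with_proj (cayley_graph G S)) \<one> p v)}"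
      using walk_arcs_apath[OF S one_closed w(2)] distinct_walk_verts[OF one_closed, of w] S
      by (auto simp: pre_digraph.apath_def)
  qed
  moreover have "inj_on (walk_arcs G \<one>) ?W"
    using S walk_arcs_inj by (intro inj_onI) blast
  ultimately show ?thesis by (simp add: saw_count_def card_image)
qed

end

text \<open>An injective homomorphism preserves and reflects triviality of products. It carries
  self-avoidance from \<open>free_product\<close> to the given group, and from
  \<open>free_group\<close> to a group with a free basis.\<close>

lemma saw_map_hom:
  assumes K: "group K" and L: "group L" and \<phi>: "\<phi> \<in> hom K L" "inj_on \<phi> (carrier K)"
  shows "set w \<subseteq> carrier K \<Longrightarrow> saw L (map \<phi> w) \<longleftrightarrow> saw K w"
proof -
  interpret K: group K by (fact K)
  interpret L: group L by (fact L)
  interpret group_hom K L \<phi> by unfold_locales (fact \<phi>)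
  have prod: "set u \<subseteq> carrier K \<Longrightarrow> word_prod L (map \<phi> u) = \<phi> (word_prod K u)" for u
    by (induction u) auto
  have one: "set u \<subseteq> carrier K \<Longrightarrow> word_prod L (map \<phi> u) = \<one>\<^bsub>L\<^esub> \<longleftrightarrow> word_prod K u = \<one>\<^bsub>K\<^esub>" for u
    using prod[of u] \<phi>(2) hom_one K.one_closed K.word_prod_closed[of u] by (metis inj_onD)
  show "set w \<subseteq> carrier K \<Longrightarrow> saw L (map \<phi> w) \<longleftrightarrow> saw K w"
  proof (induction w)
    case (Cons s w)
    have *: "prefix v (map \<phi> w) \<longleftrightarrow> (\<exists>u. prefix u w \<and> v = map \<phi> u)" for v
      by (auto simp: map_mono_prefix dest: prefix_map_rightE)
    have "word_prod L (map \<phi> (s # u)) = \<one>\<^bsub>L\<^esub> \<longleftrightarrow> word_prod K (s # u) = \<one>\<^bsub>K\<^esub>" if "prefix u w" for u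
      using one[of "s # u"] set_mono_prefix[OF that] Cons.prems by auto
    then show ?case using Cons * by (auto simp del: word_prod_Cons)
  qed simp
qed

section \<open>Free products\<close>

text \<open>Empty if \<open>w\<close> starts in another factor, so that a letter of factor
  \<open>i\<close> put in front then opens a block of its own.\<close>

definition first_block :: "'i \<Rightarrow> ('i \<times> 'a) list \<Rightarrow> 'a list" where
  "first_block i w = map snd (takeWhile (\<lambda>x. fst x = i) w)"

text \<open>
  Only the maximal blocks of letters from one factor need to be self-avoiding, because a product of
  nontrivial blocks from alternating factors is a nonempty reduced word.
\<close>

primrec fp_saw :: "('i \<Rightarrow> ('a, 'c) monoid_scheme) \<Rightarrow> ('i \<times> 'a) list \<Rightarrow> bool" where
  "fp_saw H [] \<longleftrightarrow> True"
| "fp_saw H (x # w) \<longleftrightarrow> saw (H (fst x)) (snd x # first_block (fst x) w) \<and> fp_saw H w"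

lemma first_block_Nil [simp]: "first_block i [] = []"
  and first_block_Cons [simp]:
    "first_block i (x # w) = (if fst x = i then snd x # first_block i w else [])"
  by (simp_all add: first_block_def)

lemma set_first_block: "set (first_block i w) \<subseteq> {s. (i, s) \<in> set w}"
  by (induction w) auto

lemma first_block_prefix: "prefix u w \<Longrightarrow> prefix (first_block i u) (first_block i w)"
  by (induction w arbitrary: u) (auto simp: prefix_Cons)

lemma prefix_first_block: "prefix v (first_block i w) \<Longrightarrow> prefix (map (Pair i) v) w"
proof (induction w arbitrary: v)
  case (Cons x w)
  then show ?case by (cases v) (auto split: if_splits)
qed simp

lemma fp_saw_first_block: "fp_saw H w \<Longrightarrow> saw (H i) (first_block i w)"
  by (cases w) auto

lemma fp_saw_prefix: "fp_saw H w \<Longrightarrow> prefix u w \<Longrightarrow> fp_saw H u"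
proof (induction w arbitrary: u)
  case (Cons x w)
  show ?case
  proof (cases u)
    case (Cons y v)
    then have "prefix v w" "y = x" using Cons.prems by auto
    then have "prefix (snd x # first_block (fst x) v) (snd x # first_block (fst x) w)"
      by (simp add: first_block_prefix)
    moreover have "saw (H (fst x)) (snd x # first_block (fst x) w)" "fp_saw H w"
      using Cons.prems by auto
    ultimately have "saw (H (fst x)) (snd x # first_block (fst x) v)" "fp_saw H v"
      using saw_prefix Cons.IH \<open>prefix v w\<close> by blast+
    then show ?thesis using Cons \<open>y = x\<close> by simp
  qed simp
qed simp

lemma word_prod_free_product:
  "word_prod (free_product I H) (map (\<lambda>x. [x]) w) = foldr (fp_cons H) w []"
  by (induction w) (auto simp: free_product_def)

context
  fixes I :: "'i set" and H :: "'i \<Rightarrow> ('a, 'c) monoid_scheme"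
  assumes H: "\<forall>i\<in>I. group (H i)"
begin

lemma foldr_fp_cons_block:
  assumes i: "i \<in> I" and u: "set u \<subseteq> carrier (H i)"
  shows "foldr (fp_cons H) (map (Pair i) u) [] = fp_inj H i (word_prod (H i) u)"
proof -
  interpret group "H i" using H i by blast
  show ?thesis using u by (induction u) (auto simp: fp_inj_def)
qed

text \<open>This is an invariant of reduction: the whole first block has collapsed into the first
  syllable of the normal form. A new letter of the same factor is multiplied into that syllable
  without giving the identity, by self-avoidance; a letter of another factor becomes a new
  syllable.\<close>

lemma foldr_fp_cons_fp_saw:
  "set w \<subseteq> (SIGMA i:I. carrier (H i)) \<Longrightarrow> fp_saw H w \<Longrightarrow> w \<noteq> [] \<Longrightarrow>
    \<exists>r. foldr (fp_cons H) w [] =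
      (fst (hd w), word_prod (H (fst (hd w))) (first_block (fst (hd w)) w)) # r"
proof (induction w)
  case (Cons x w)
  obtain i a where x: "x = (i, a)" by force
  interpret group "H i" using H Cons.prems x by auto
  have a: "a \<in> carrier (H i)" using Cons.prems x by auto
  have saw: "saw (H i) (a # first_block i w)" "fp_saw H w" using Cons.prems x by auto
  then have nt: "a \<otimes>\<^bsub>H i\<^esub> word_prod (H i) (first_block i w) \<noteq> \<one>\<^bsub>H i\<^esub>" by simp
  show ?case
  proof (cases w)
    case Nil
    then show ?thesis using nt a x by (auto simp: fp_inj_def)
  next
    case (Cons y v)
    obtain j b where y: "y = (j, b)" by force
    obtain r where r: "foldr (fp_cons H) w [] = (j, word_prod (H j) (first_block j w)) # r"
      using Cons.IH Cons.prems saw(2) Cons y by auto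
    have "word_prod (H i) [a] \<noteq> \<one>\<^bsub>H i\<^esub>" using saw(1) by (metis Nil_prefix saw.simps(2))
    then have "a \<noteq> \<one>\<^bsub>H i\<^esub>" by auto
    then show ?thesis
      using r nt x y Cons a by (cases "i = j") (auto simp: fp_inj_def)
  qed
qed simp

text \<open>A trivial subword of a block is a trivial subword of the whole word. Conversely, if all
  blocks are self-avoiding, every nonempty prefix has a nonempty normal form.\<close>

lemma saw_free_product:
  "set w \<subseteq> (SIGMA i:I. carrier (H i)) \<Longrightarrow>
    saw (free_product I H) (map (\<lambda>x. [x]) w) \<longleftrightarrow> fp_saw H w"
proof (induction w)
  case (Cons x w)
  obtain i a where x: "x = (i, a)" by force
  have i: "i \<in> I" and w: "set w \<subseteq> (SIGMA i:I. carrier (H i))" using Cons.prems x by auto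
  have *: "prefix v (map (\<lambda>x. [x]) w) \<longleftrightarrow> (\<exists>u. prefix u w \<and> v = map (\<lambda>x. [x]) u)" for v
    by (auto simp: prefix_map_rightE map_mono_prefix dest: prefix_map_rightE)
  have "saw (free_product I H) (map (\<lambda>x. [x]) (x # w)) \<longleftrightarrow>
      (\<forall>u. prefix u w \<longrightarrow> foldr (fp_cons H) (x # u) [] \<noteq> []) \<and> fp_saw H w"
  proof -
    have "word_prod (free_product I H) ([x] # map (\<lambda>x. [x]) u) = foldr (fp_cons H) (x # u) []" for u
      using word_prod_free_product[of I H "x # u"] by simp
    moreover have "\<one>\<^bsub>free_product I H\<^esub> = []" by (simp add: free_product_def)
    ultimately show ?thesis using Cons.IH[OF w] * by (auto simp del: word_prod_Cons)
  qed
  also have "\<dots> \<longleftrightarrow> fp_saw H (x # w)"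
  proof (intro iffI conjI)
    assume L: "(\<forall>u. prefix u w \<longrightarrow> foldr (fp_cons H) (x # u) [] \<noteq> []) \<and> fp_saw H w"
    have "word_prod (H i) (a # v) \<noteq> \<one>\<^bsub>H i\<^esub>" if v: "prefix v (first_block i w)" for v
    proof -
      have pv: "prefix (map (Pair i) v) w" using prefix_first_block[OF v] .
      then have "set (map (Pair i) (a # v)) \<subseteq> (SIGMA i:I. carrier (H i))"
        using set_mono_prefix[OF pv] Cons.prems x by auto
      then have "set (a # v) \<subseteq> carrier (H i)" by auto
      from foldr_fp_cons_block[OF i this] show ?thesis
        using L pv x by (auto simp: fp_inj_def)
    qed
    then show "fp_saw H (x # w)" using L x fp_saw_first_block[of H w i] by simp
  next
    assume R: "fp_saw H (x # w)"
    show "\<forall>u. prefix u w \<longrightarrow> foldr (fp_cons H) (x # u) [] \<noteq> []"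
    proof (intro allI impI)
      fix u assume u: "prefix u w"
      have "fp_saw H (x # u)" using fp_saw_prefix[OF R, of "x # u"] u by simp
      moreover have "set (x # u) \<subseteq> (SIGMA i:I. carrier (H i))"
        using set_mono_prefix[OF u] Cons.prems by auto
      ultimately show "foldr (fp_cons H) (x # u) [] \<noteq> []"
        using foldr_fp_cons_fp_saw[of "x # u"] by auto
    qed
    show "fp_saw H w" using R by simp
  qed
  finally show ?case .
qed simp

end

section \<open>The graph of first blocks\<close>

text \<open>Length 3 appears as \<open>Suc 2\<close> to match the consecutive closed walks of the
  Perron-Frobenius criterion.\<close>

lemma relpow_2_3:
  shows "(a, b) \<in> E \<Longrightarrow> (b, c) \<in> E \<Longrightarrow> (a, c) \<in> E ^^ 2"
    and "(a, b) \<in> E \<Longrightarrow> (b, c) \<in> E \<Longrightarrow> (c, d) \<in> E \<Longrightarrow> (a, d) \<in> E ^^ Suc 2"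
  by (auto simp: numeral_2_eq_2)

text \<open>This is what a standard generating set supplies, freed from the isomorphisms. Of the
  free factor only a local rule is kept: self-avoidance is tested on adjacent letters. The
  assumption \<open>large\<close> excludes systems in which at most one factor has letters and that
  factor is finite; there the words would have bounded length.\<close>

locale standard_system =
  fixes k :: nat and K :: "nat \<Rightarrow> ('g, 'c) monoid_scheme" and T :: "nat \<Rightarrow> 'g set"
  assumes grp: "i \<le> k \<Longrightarrow> group (K i)"
    and T_finite: "i \<le> k \<Longrightarrow> finite (T i)"
    and T_carrier: "i \<le> k \<Longrightarrow> T i \<subseteq> carrier (K i)"
    and T_one: "i \<le> k \<Longrightarrow> \<one>\<^bsub>K i\<^esub> \<notin> T i"
    and T_inv: "i \<le> k \<Longrightarrow> s \<in> T i \<Longrightarrow> inv\<^bsub>K i\<^esub> s \<in> T i"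
    and finite_factor: "i < k \<Longrightarrow> finite (carrier (K i))"
    and free_saw: "set (s # t # u) \<subseteq> T k \<Longrightarrow> saw (K k) (t # u) \<Longrightarrow>
      saw (K k) (s # t # u) \<longleftrightarrow> s \<noteq> inv\<^bsub>K k\<^esub> t"
    and free_inv: "s \<in> T k \<Longrightarrow> inv\<^bsub>K k\<^esub> s \<noteq> s"
    and large: "T k \<noteq> {} \<or> (\<exists>i\<le>k. \<exists>j\<le>k. i \<noteq> j \<and> T i \<noteq> {} \<and> T j \<noteq> {})"
begin

definition letters :: "(nat \<times> 'g) set" where
  "letters = (SIGMA i:{..k}. T i)"

definition trim :: "nat \<Rightarrow> 'g list \<Rightarrow> 'g list" where
  "trim i u = (if i < k then u else [hd u])"

text \<open>The head of the empty word is unspecified, so this is meaningful for nonempty words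
  only; hence the conditions \<open>n > 0\<close> below.\<close>

definition state :: "(nat \<times> 'g) list \<Rightarrow> nat \<times> 'g list" where
  "state w = (fst (hd w), trim (fst (hd w)) (first_block (fst (hd w)) w))"

definition readable :: "nat \<times> 'g list \<Rightarrow> (nat \<times> 'g) set" where
  "readable q = {x \<in> letters. fst x \<noteq> fst q \<or> saw (K (fst x)) (snd x # snd q)}"

definition after :: "nat \<times> 'g list \<Rightarrow> nat \<times> 'g \<Rightarrow> nat \<times> 'g list" where
  "after q x = (fst x, if fst x = fst q then trim (fst x) (snd x # snd q) else [snd x])"

definition states :: "(nat \<times> 'g list) set" where
  "states = {(i, u). i \<le> k \<and> u \<noteq> [] \<and> set u \<subseteq> T i \<and> saw (K i) u \<and> (i = k \<longrightarrow> length u = 1)}"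

lemma saw_single: "i \<le> k \<Longrightarrow> s \<in> T i \<Longrightarrow> saw (K i) [s]"
proof -
  assume i: "i \<le> k" and s: "s \<in> T i"
  interpret group "K i" using grp i by blast
  show "saw (K i) [s]" using i s T_carrier[of i] T_one[of i] by auto
qed

lemma finite_letters: "finite letters"
  unfolding letters_def using T_finite by auto

lemma finite_saw_words:
  assumes i: "i < k"
  shows "finite {w. set w \<subseteq> T i \<and> saw (K i) w}"
proof -
  interpret group "K i" using grp i by simp
  have "{w. set w \<subseteq> T i \<and> saw (K i) w} \<subseteq> {w. set w \<subseteq> T i \<and> length w \<le> card (carrier (K i))}"
  proof (intro subsetI CollectI conjI)
    fix w assume w: "w \<in> {w. set w \<subseteq> T i \<and> saw (K i) w}"
    then have "set w \<subseteq> carrier (K i)" using T_carrier[of i] i by auto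
    then show "length w \<le> card (carrier (K i))"
      using saw_length_less[OF finite_factor[OF i], of w] w by simp
  qed auto
  then show ?thesis
    by (rule finite_subset) (use T_finite i in \<open>auto intro: finite_lists_length_le\<close>)
qed

lemma finite_states: "finite states"
proof -
  have "states \<subseteq> (SIGMA i:{..<k}. {w. set w \<subseteq> T i \<and> saw (K i) w}) \<union> ({k} \<times> (\<lambda>s. [s]) ` T k)"
    by (auto simp: states_def length_Suc_conv)
  moreover have "finite \<dots>" using finite_saw_words T_finite by auto
  ultimately show ?thesis using finite_subset by blast
qed

lemma after_state:
  assumes q: "q \<in> states" and x: "x \<in> readable q"
  shows "after q x \<in> states"
proof -
  obtain i u j s where iu: "q = (i, u)" "x = (j, s)" by (metis surj_pair)
  have j: "j \<le> k" "s \<in> T j" using x iu by (auto simp: readable_def letters_def)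
  show ?thesis
    using q x iu j saw_single[OF j]
    by (auto simp: states_def readable_def after_def trim_def simp del: saw.simps)
qed

text \<open>The letter read is the head of the new block. Sums over letters are therefore sums over
  successor states, without multiplicities.\<close>

lemma after_inj: "inj_on (after q) (readable q)"
  by (rule inj_on_inverseI[of _ "\<lambda>r. (fst r, hd (snd r))"]) (auto simp: after_def trim_def)

text \<open>The state is all of \<open>w\<close> that matters for prepending. In the free factor,
  forgetting the rest of the block is harmless because \<open>free_saw\<close> compares only the two
  adjacent letters.\<close>

lemma fp_saw_Cons:
  assumes w: "fp_saw K w" "set w \<subseteq> letters" "w \<noteq> []" and x: "x \<in> letters"
  shows "fp_saw K (x # w) \<longleftrightarrow> x \<in> readable (state w)"
    and "state (x # w) = after (state w) x"
proof -
  obtain j t v where v: "w = (j, t) # v" using w(3) by (cases w) auto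
  obtain i s where x': "x = (i, s)" by force
  have ij: "i \<le> k" "s \<in> T i" "j \<le> k" "t \<in> T j" using x' x v w(2) by (auto simp: letters_def)
  show "fp_saw K (x # w) \<longleftrightarrow> x \<in> readable (state w)"
  proof (cases "i = j")
    case False
    then show ?thesis using w(1) x x' v saw_single ij by (auto simp: readable_def state_def)
  next
    case True
    let ?u = "first_block i v"
    have u: "set ?u \<subseteq> T i" using set_first_block[of i v] v w(2) by (auto simp: letters_def)
    have saw: "saw (K i) (t # ?u)" using w(1) v True by simp
    have "saw (K i) (s # t # ?u) \<longleftrightarrow> saw (K i) (s # trim i (t # ?u))"
    proof (cases "i = k")
      case k: True
      then show ?thesis
        using free_saw[of s t ?u] free_saw[of s t "[]"] u ij saw saw_single True
        by (auto simp: trim_def simp del: saw.simps)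
    qed (use ij in \<open>auto simp: trim_def\<close>)
    then show ?thesis using w(1) x x' v True by (auto simp: readable_def state_def)
  qed
  show "state (x # w) = after (state w) x"
    using x' v by (auto simp: state_def after_def trim_def)
qed

lemma state_in_states:
  assumes w: "fp_saw K w" "set w \<subseteq> letters" "w \<noteq> []"
  shows "state w \<in> states"
proof -
  obtain i t v where v: "w = (i, t) # v" using w(3) by (cases w) auto
  have i: "i \<le> k" "t \<in> T i" using v w(2) by (auto simp: letters_def)
  have "set (first_block i v) \<subseteq> T i" using set_first_block[of i v] v w(2) by (auto simp: letters_def)
  then show ?thesis using i v w(1) saw_single[OF i] by (auto simp: states_def state_def trim_def)
qed

section \<open>Counting words with a positive eigenvector\<close>

definition language :: "nat \<Rightarrow> (nat \<times> 'g) list set" where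
  "language n = {w. length w = n \<and> set w \<subseteq> letters \<and> fp_saw K w}"

lemma finite_language: "finite (language n)"
  using finite_lists_length_eq[OF finite_letters, of n]
  by (rule rev_finite_subset) (auto simp: language_def)

lemma language_Suc:
  assumes "n > 0"
  shows "language (Suc n) = (\<lambda>(w, x). x # w) ` (SIGMA w:language n. readable (state w))"
proof (intro equalityI subsetI)
  fix v assume v: "v \<in> language (Suc n)"
  then obtain x w where "v = x # w" by (cases v) (auto simp: language_def)
  then have "w \<in> language n" "x \<in> readable (state w)"
    using v assms fp_saw_Cons(1)[of w x] by (auto simp: language_def)
  then show "v \<in> (\<lambda>(w, x). x # w) ` (SIGMA w:language n. readable (state w))"
    using \<open>v = x # w\<close> by force
next
  fix v assume "v \<in> (\<lambda>(w, x). x # w) ` (SIGMA w:language n. readable (state w))"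
  then obtain x w where v: "v = x # w" "w \<in> language n" "x \<in> readable (state w)" by auto
  then have "fp_saw K (x # w)"
    using assms fp_saw_Cons(1)[of w x] by (auto simp: language_def readable_def)
  then show "v \<in> language (Suc n)" using v by (auto simp: language_def readable_def)
qed

lemma letters_nonempty: "letters \<noteq> {}"
  using large by (auto simp: letters_def)

text \<open>Weighting each word by \<open>h\<close> of its state turns the eigenvector equation into
  an exact geometric recursion. The weights lie between two positive constants, whose effect
  vanishes under the \<open>n\<close>-th root.\<close>

lemma language_growth:
  assumes h: "\<And>q. q \<in> states \<Longrightarrow> h q > 0"
    and hl: "\<And>q. q \<in> states \<Longrightarrow> (\<Sum>x\<in>readable q. h (after q x)) = l * h q"
    and l: "l > (0 :: real)"
  shows "(\<lambda>n. root n (card (language n))) \<longlonglongrightarrow> l"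
proof -
  define W where "W = (\<lambda>n. \<Sum>w\<in>language n. h (state w))"
  have st: "state w \<in> states" if "w \<in> language n" "n > 0" for w n
    using that state_in_states by (auto simp: language_def)
  have W_Suc: "W (Suc n) = l * W n" if n: "n > 0" for n
  proof -
    have "W (Suc n) = (\<Sum>(w, x)\<in>(SIGMA w:language n. readable (state w)). h (state (x # w)))"
      unfolding W_def language_Suc[OF n]
      by (subst sum.reindex) (auto simp: inj_on_def case_prod_unfold)
    also have "\<dots> = (\<Sum>(w, x)\<in>(SIGMA w:language n. readable (state w)). h (after (state w) x))"
      using n by (intro sum.cong) (auto simp: language_def readable_def fp_saw_Cons(2))
    also have "\<dots> = (\<Sum>w\<in>language n. \<Sum>x\<in>readable (state w). h (after (state w) x))"
      using finite_letters by (subst sum.Sigma[OF finite_language]) (auto simp: readable_def)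
    also have "\<dots> = (\<Sum>w\<in>language n. l * h (state w))"
      using st n hl by (intro sum.cong) auto
    finally show ?thesis by (simp add: W_def sum_distrib_left)
  qed
  define c where "c = W 1"
  have W: "W (Suc n) = l ^ n * c" for n
    by (induction n) (simp_all add: W_Suc c_def)
  have "language 1 \<noteq> {}"
  proof -
    obtain x where "x \<in> letters" using letters_nonempty by blast
    moreover have "fp_saw K [x]"
      using \<open>x \<in> letters\<close> saw_single by (auto simp: letters_def simp del: saw.simps)
    ultimately have "[x] \<in> language 1" by (auto simp: language_def)
    then show ?thesis by blast
  qed
  then have c: "c > 0"
    unfolding c_def W_def using finite_language st h by (intro sum_pos) auto
  define m where "m = Min (h ` states)"
  define M where "M = Max (h ` states)"
  have "states \<noteq> {}" using \<open>language 1 \<noteq> {}\<close> st by fastforce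
  then have m: "m > 0" "\<And>q. q \<in> states \<Longrightarrow> m \<le> h q" and M: "\<And>q. q \<in> states \<Longrightarrow> h q \<le> M"
    using finite_states h by (auto simp: m_def M_def)
  have M0: "M > 0" using \<open>states \<noteq> {}\<close> h M by (meson ex_in_conv less_le_trans)
  \<comment> \<open>The factor \<open>l\<close> in the denominators is there because the recursion
    starts at length 1: \<open>W n\<close> is \<open>l ^ (n - 1) * c\<close>.\<close>
  define a b where "a = c / (M * l)" and "b = c / (m * l)"
  have ab: "a > 0" "b > 0" using c M0 m l by (auto simp: a_def b_def)
  have lower: "a * l ^ n \<le> card (language n)" and upper: "card (language n) \<le> b * l ^ n" if n: "n > 0" for n
  proof -
    obtain n' where n': "n = Suc n'" using n by (cases n) auto
    have "W n \<le> (\<Sum>w\<in>language n. M)" unfolding W_def using M st n by (intro sum_mono) auto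
    then have "l ^ n' * c \<le> M * card (language n)" using W n' by (simp add: mult.commute)
    then show "a * l ^ n \<le> card (language n)"
      using M0 l n' by (simp add: a_def field_simps)
    have "(\<Sum>w\<in>language n. m) \<le> W n" unfolding W_def using m st n by (intro sum_mono) auto
    then have "m * card (language n) \<le> l ^ n' * c" using W n' by (simp add: mult.commute)
    then show "card (language n) \<le> b * l ^ n"
      using m l n' by (simp add: b_def field_simps)
  qed
  have lim: "(\<lambda>n. root n (d * l ^ n)) \<longlonglongrightarrow> l" if "d > 0" for d
  proof -
    have "(\<lambda>n. root n d * l) \<longlonglongrightarrow> 1 * l" by (intro tendsto_intros LIMSEQ_root_const that)
    moreover have "eventually (\<lambda>n. root n d * l = root n (d * l ^ n)) sequentially"
      using eventually_gt_at_top[of 0]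
      by eventually_elim (use l in \<open>simp add: real_root_mult real_root_power_cancel\<close>)
    ultimately show ?thesis using Lim_transform_eventually by fastforce
  qed
  show ?thesis
  proof (rule tendsto_sandwich[OF _ _ lim[OF ab(1)] lim[OF ab(2)]])
    show "eventually (\<lambda>n. root n (a * l ^ n) \<le> root n (card (language n))) sequentially"
      using eventually_gt_at_top[of 0] by eventually_elim (use lower in simp)
    show "eventually (\<lambda>n. root n (card (language n)) \<le> root n (b * l ^ n)) sequentially"
      using eventually_gt_at_top[of 0] by eventually_elim (use upper in simp)
  qed
qed

section \<open>Extension polynomials and the eigenvector\<close>

definition extensions :: "nat \<Rightarrow> 'g list \<Rightarrow> 'g list set" where
  "extensions i u = {w. set w \<subseteq> T i \<and> saw (K i) (w @ u)}"

definition ext_poly :: "nat \<Rightarrow> 'g list \<Rightarrow> real \<Rightarrow> real" where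
  "ext_poly i u x = (\<Sum>w\<in>extensions i u. x ^ length w)"

lemma finite_extensions:
  assumes "i < k" "set u \<subseteq> T i"
  shows "finite (extensions i u)"
proof -
  have "finite ((\<lambda>w. w @ u) -` {w. set w \<subseteq> T i \<and> saw (K i) w})"
    by (intro finite_vimageI finite_saw_words assms) (auto simp: inj_def)
  then show ?thesis
    by (rule rev_finite_subset) (use assms in \<open>auto simp: extensions_def\<close>)
qed

text \<open>The extensions are sorted by their last letter, the one adjacent to \<open>u\<close> and
  thus the first to be put in front of it. The summand 1 is the empty extension.\<close>

lemma ext_poly_rec:
  assumes i: "i < k" and u: "set u \<subseteq> T i" "saw (K i) u"
  shows "ext_poly i u x = 1 + x * (\<Sum>s | s \<in> T i \<and> saw (K i) (s # u). ext_poly i (s # u) x)"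
proof -
  let ?R = "{s \<in> T i. saw (K i) (s # u)}"
  have fin: "finite ?R" "\<And>s. s \<in> ?R \<Longrightarrow> finite (extensions i (s # u))"
    using T_finite i finite_extensions u by auto
  have ext: "extensions i u = insert [] ((\<lambda>(s, w). w @ [s]) ` (SIGMA s:?R. extensions i (s # u)))"
    (is "_ = insert [] ?V")
  proof (intro equalityI subsetI)
    fix w assume w: "w \<in> extensions i u"
    show "w \<in> insert [] ?V"
    proof (cases w rule: rev_cases)
      case (snoc v s)
      then have v: "set v \<subseteq> T i" "s \<in> T i" "saw (K i) (v @ s # u)"
        using w by (auto simp: extensions_def)
      then have "saw (K i) (s # u)" using saw_appendD by blast
      then have "(s, v) \<in> (SIGMA s:?R. extensions i (s # u))" using v by (auto simp: extensions_def)
      then show ?thesis using snoc by force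
    qed simp
  qed (use u in \<open>auto simp: extensions_def simp del: saw.simps\<close>)
  have "ext_poly i u x = 1 + (\<Sum>w\<in>?V. x ^ length w)"
    unfolding ext_poly_def ext using fin by (subst sum.insert) (auto intro!: finite_imageI)
  also have "(\<Sum>w\<in>?V. x ^ length w) = (\<Sum>(s, w)\<in>(SIGMA s:?R. extensions i (s # u)). x * x ^ length w)"
    by (subst sum.reindex) (auto simp: inj_on_def case_prod_unfold)
  also have "\<dots> = (\<Sum>s\<in>?R. \<Sum>w\<in>extensions i (s # u). x * x ^ length w)"
    using fin by (subst sum.Sigma) auto
  finally show ?thesis by (simp add: ext_poly_def sum_distrib_left)
qed

lemma ext_poly_ge_one:
  assumes "i < k" "set u \<subseteq> T i" "saw (K i) u" "x \<ge> 0"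
  shows "ext_poly i u x \<ge> 1"
proof -
  have "x ^ length ([] :: 'g list) \<le> ext_poly i u x"
    unfolding ext_poly_def
    by (rule member_le_sum) (use assms finite_extensions in \<open>auto simp: extensions_def\<close>)
  then show ?thesis by simp
qed

text \<open>
  The reciprocal growth rate is the root of \<open>total_weight = 1\<close>: with \<open>A\<^sub>j = ext_poly j [] - 1\<close> the generating
  function of nontrivial self-avoiding walks in the \<open>j\<close>-th finite factor, the summands are
  \<open>A\<^sub>j / (1 + A\<^sub>j)\<close>, and each letter of the free factor contributes \<open>x / (1 + x)\<close>.
\<close>

definition total_weight :: "real \<Rightarrow> real" where
  "total_weight x = (\<Sum>j<k. 1 - 1 / ext_poly j [] x) + card (T k) * (x / (1 + x))"

lemma ext_poly_Nil_rec:
  assumes "i < k"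
  shows "ext_poly i [] x = 1 + x * (\<Sum>s\<in>T i. ext_poly i [s] x)"
proof -
  have "{s. s \<in> T i \<and> saw (K i) [s]} = T i" using assms saw_single by (auto simp del: saw.simps)
  then show ?thesis using ext_poly_rec[OF assms, of "[]" x] by simp
qed

text \<open>Intermediate values: at 0 the weight is 0, while at 1 every finite factor with letters
  contributes at least 1/2 and every free letter exactly 1/2. Two such contributions exist by
  \<open>large\<close>, a free letter coming with its inverse. A root that is at most 1 makes the
  eigenvalue \<open>1 / x\<close> at least 1.\<close>

lemma total_weight_root:
  obtains x where "0 < x" "x \<le> 1" "total_weight x = 1"
proof -
  have cont: "continuous_on {0..1} total_weight"
    unfolding total_weight_def
  proof (intro continuous_intros ballI)
    show "continuous_on {0..1} (ext_poly j [])" for j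
      unfolding ext_poly_def by (intro continuous_intros)
    show "ext_poly j [] x \<noteq> 0" if "j \<in> {..<k}" "x \<in> {0..1}" for j x
      using ext_poly_ge_one[of j "[]" x] that by auto
  qed auto
  have zero: "total_weight 0 = 0"
    by (auto simp: total_weight_def ext_poly_Nil_rec)
  have nonneg: "1 - 1 / ext_poly j [] 1 \<ge> 0" if "j < k" for j
    using ext_poly_ge_one[of j "[]" 1] that by simp
  have half: "1 - 1 / ext_poly j [] 1 \<ge> 1 / 2" if j: "j < k" "T j \<noteq> {}" for j
  proof -
    obtain s where s: "s \<in> T j" using j by blast
    have ge: "ext_poly j [t] 1 \<ge> 1" if "t \<in> T j" for t
      using j saw_single that by (intro ext_poly_ge_one) (auto simp del: saw.simps)
    have "1 \<le> ext_poly j [s] 1" using ge s by blast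
    also have "\<dots> \<le> (\<Sum>t\<in>T j. ext_poly j [t] 1)"
      using s j T_finite ge by (intro member_le_sum) (auto intro: order_trans[OF zero_le_one])
    finally have "ext_poly j [] 1 \<ge> 2" by (simp add: ext_poly_Nil_rec j)
    then show ?thesis by (simp add: field_simps)
  qed
  have sum0: "(\<Sum>j<k. 1 - 1 / ext_poly j [] 1) \<ge> 0" using nonneg by (intro sum_nonneg) auto
  have "total_weight 1 \<ge> 1"
  proof (cases "T k = {}")
    case False
    then obtain s where "s \<in> T k" by blast
    then have "card {s, inv\<^bsub>K k\<^esub> s} \<le> card (T k)"
      using T_inv by (intro card_mono T_finite) auto
    then have "2 \<le> card (T k)" using free_inv[OF \<open>s \<in> T k\<close>] by simp
    then show ?thesis using sum0 by (simp add: total_weight_def)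
  next
    case True
    then obtain i j where "i \<le> k" "j \<le> k" "i \<noteq> j" "T i \<noteq> {}" "T j \<noteq> {}"
      using large by blast
    moreover from this True have "i \<noteq> k" "j \<noteq> k" by auto
    ultimately have ij: "i < k" "j < k" "i \<noteq> j" "T i \<noteq> {}" "T j \<noteq> {}" by auto
    have "1 \<le> (\<Sum>j\<in>{i, j}. 1 - 1 / ext_poly j [] 1)"
      using half[OF ij(1,4)] half[OF ij(2,5)] ij(3) by simp
    also have "\<dots> \<le> (\<Sum>j<k. 1 - 1 / ext_poly j [] 1)"
      using ij nonneg by (intro sum_mono2) auto
    finally show ?thesis using True by (simp add: total_weight_def)
  qed
  then obtain x where x: "0 \<le> x" "x \<le> 1" "total_weight x = 1"
    using IVT'[of total_weight 0 1 1] cont zero by auto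
  then have "x \<noteq> 0" using zero by auto
  then show ?thesis using that[of x] x by simp
qed

definition weight :: "real \<Rightarrow> nat \<times> 'g list \<Rightarrow> real" where
  "weight x q = (if fst q < k then ext_poly (fst q) (snd q) x / ext_poly (fst q) [] x else 1 / (1 + x))"

lemma weight_pos: "q \<in> states \<Longrightarrow> x \<ge> 0 \<Longrightarrow> weight x q > 0"
proof (cases "fst q < k")
  case True
  assume q: "q \<in> states" and x: "x \<ge> 0"
  have "set (snd q) \<subseteq> T (fst q)" "saw (K (fst q)) (snd q)"
    using q unfolding states_def by auto
  then have "ext_poly (fst q) (snd q) x \<ge> 1" "ext_poly (fst q) [] x \<ge> 1"
    using True x ext_poly_ge_one by auto
  then show ?thesis using True by (simp add: weight_def)
qed (simp add: weight_def)

text \<open>Let \<open>g j\<close> be the total weight of the states entered by opening a block in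
  factor \<open>j\<close>; then \<open>x * g j\<close> is the \<open>j\<close>-th summand of
  \<open>total_weight\<close>. After multiplication by \<open>x\<close>, the letters that leave
  factor \<open>i\<close> contribute \<open>1 - x * g i\<close>, and those that stay supply the
  rest, by \<open>ext_poly_rec\<close> in a finite factor.\<close>

lemma weight_eigen:
  assumes x: "0 < x" "total_weight x = 1" and q: "q \<in> states"
  shows "(\<Sum>y\<in>readable q. weight x (after q y)) = 1 / x * weight x q"
proof -
  obtain i u where iu: "q = (i, u)" by (cases q)
  have i: "i \<le> k" and u: "u \<noteq> []" "set u \<subseteq> T i" "saw (K i) u" and uk: "i = k \<Longrightarrow> length u = 1"
    using q iu by (auto simp: states_def)
  define g where "g j = (\<Sum>s\<in>T j. weight x (j, [s]))" for j
  have g: "x * g j = 1 - 1 / ext_poly j [] x" if "j < k" for j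
  proof -
    have "ext_poly j [] x \<noteq> 0" using ext_poly_ge_one[of j "[]" x] that x by auto
    moreover have "x * g j * ext_poly j [] x = x * (\<Sum>s\<in>T j. ext_poly j [s] x)"
      using that calculation by (simp add: g_def weight_def sum_divide_distrib[symmetric])
    ultimately show ?thesis using ext_poly_Nil_rec[OF that, of x] by (simp add: field_simps)
  qed
  have gk: "x * g k = card (T k) * (x / (1 + x))" by (simp add: g_def weight_def)
  have total: "x * (\<Sum>j\<le>k. g j) = 1"
  proof -
    have "x * (\<Sum>j\<le>k. g j) = (\<Sum>j<k. x * g j) + x * g k"
      by (simp add: lessThan_Suc_atMost[symmetric] distrib_left sum_distrib_left)
    also have "\<dots> = total_weight x" using g gk by (simp add: total_weight_def)
    finally show ?thesis using x by simp
  qed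
  let ?R = "{s \<in> T i. saw (K i) (s # u)}"
  \<comment> \<open>Letters of other factors open a new block; those in \<open>?R\<close> lengthen
    the current one.\<close>
  have R: "readable q = (SIGMA j:{..k} - {i}. T j) \<union> Pair i ` ?R"
    using i by (auto simp: readable_def letters_def iu simp del: saw.simps)
  have fin: "finite (SIGMA j:{..k} - {i}. T j)" "finite ?R" using T_finite i by auto
  have "(\<Sum>y\<in>readable q. weight x (after q y)) =
      (\<Sum>y\<in>(SIGMA j:{..k} - {i}. T j). weight x (after q y)) + (\<Sum>y\<in>Pair i ` ?R. weight x (after q y))"
    unfolding R using fin by (intro sum.union_disjoint) auto
  also have "(\<Sum>y\<in>(SIGMA j:{..k} - {i}. T j). weight x (after q y)) = (\<Sum>j\<in>{..k} - {i}. g j)"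
  proof -
    have "(\<Sum>y\<in>(SIGMA j:{..k} - {i}. T j). weight x (after q y)) =
        (\<Sum>j\<in>{..k} - {i}. \<Sum>s\<in>T j. weight x (after q (j, s)))"
      using T_finite by (subst sum.Sigma) auto
    then show ?thesis by (simp add: g_def after_def iu)
  qed
  also have "(\<Sum>j\<in>{..k} - {i}. g j) = (\<Sum>j\<le>k. g j) - g i"
    using i by (simp add: sum_diff1)
  also have "(\<Sum>y\<in>Pair i ` ?R. weight x (after q y)) = (\<Sum>s\<in>?R. weight x (i, trim i (s # u)))"
    by (subst sum.reindex) (auto simp: inj_on_def after_def iu)
  finally have sum: "x * (\<Sum>y\<in>readable q. weight x (after q y)) =
      1 - x * g i + x * (\<Sum>s\<in>?R. weight x (i, trim i (s # u)))"
    using total by (simp add: distrib_left right_diff_distrib del: saw.simps)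
  have "x * (\<Sum>y\<in>readable q. weight x (after q y)) = weight x q"
  proof (cases "i < k")
    case True
    have "x * (\<Sum>s\<in>?R. weight x (i, trim i (s # u))) = (ext_poly i u x - 1) / ext_poly i [] x"
      using True ext_poly_rec[OF True u(2,3), of x]
      by (simp add: weight_def trim_def sum_divide_distrib[symmetric] del: saw.simps)
    then show ?thesis using sum g[OF True] True by (simp add: weight_def iu diff_divide_distrib)
  next
    case False
    then have k: "i = k" using i by simp
    then obtain t where t: "u = [t]" "t \<in> T k" using u uk by (auto simp: length_Suc_conv)
    interpret group "K k" using grp by simp
    \<comment> \<open>In the free factor exactly one letter is lost, the inverse of the current one,
      and all its states have the same weight.\<close>
    have "?R = T k - {inv\<^bsub>K k\<^esub> t}"
      using k t free_saw[of _ t "[]"] saw_single by (auto simp del: saw.simps)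
    then have "(\<Sum>s\<in>?R. weight x (i, trim i (s # u))) = g k - 1 / (1 + x)"
      using T_inv[of k t] t T_finite[of k] k
        sum_diff1[of "T k" "\<lambda>s. weight x (k, [s])" "inv\<^bsub>K k\<^esub> t"]
      by (simp add: g_def trim_def weight_def[of x "(k, [inv\<^bsub>K k\<^esub> t])"] del: saw.simps)
    then have "x * (\<Sum>y\<in>readable q. weight x (after q y)) = 1 - x * (1 / (1 + x))"
      unfolding sum k by (simp add: right_diff_distrib)
    also have "\<dots> = 1 / (1 + x)" using x by (simp add: field_simps)
    finally show ?thesis using k by (simp add: weight_def iu)
  qed
  then show ?thesis using x by (simp add: field_simps)
qed

section \<open>Connectivity and period of the state graph\<close>

definition successors :: "nat \<times> 'g list \<Rightarrow> (nat \<times> 'g list) set" where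
  "successors q = after q ` readable q"

abbreviation edges :: "((nat \<times> 'g list) \<times> (nat \<times> 'g list)) set" where
  "edges \<equiv> {(q, r). q \<in> states \<and> r \<in> successors q}"

lemma single_state: "j \<le> k \<Longrightarrow> s \<in> T j \<Longrightarrow> (j, [s]) \<in> states"
  using saw_single by (auto simp: states_def simp del: saw.simps)

lemma edge_switch:
  assumes "q \<in> states" "j \<le> k" "s \<in> T j" "fst q \<noteq> j"
  shows "(q, (j, [s])) \<in> edges"
proof -
  have "(j, s) \<in> readable q" using assms by (auto simp: readable_def letters_def)
  moreover have "after q (j, s) = (j, [s])" using assms by (auto simp: after_def)
  ultimately show ?thesis using assms(1) unfolding successors_def by force
qed

lemma edge_extend:
  assumes "(j, s # u) \<in> states" "j < k" "u \<noteq> []"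
  shows "((j, u), (j, s # u)) \<in> edges"
proof -
  have "(j, u) \<in> states" using assms by (auto simp: states_def)
  moreover have "(j, s) \<in> readable (j, u)"
    using assms by (auto simp: states_def readable_def letters_def)
  moreover have "after (j, u) (j, s) = (j, s # u)" using assms by (auto simp: after_def trim_def)
  ultimately show ?thesis unfolding successors_def by force
qed

lemma edge_free:
  assumes "s \<in> T k" "t \<in> T k" "t \<noteq> inv\<^bsub>K k\<^esub> s"
  shows "((k, [s]), (k, [t])) \<in> edges"
proof -
  have "saw (K k) [t, s]" using assms free_saw[of t s "[]"] saw_single by simp
  then have "(k, t) \<in> readable (k, [s])"
    using assms by (simp add: readable_def letters_def del: saw.simps)
  moreover have "after (k, [s]) (k, t) = (k, [t])" by (simp add: after_def trim_def)
  ultimately show ?thesis using single_state[of k s] assms unfolding successors_def by force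
qed

text \<open>A block is built from its last letter: that letter enters the factor, and the others are
  put in front one at a time. In the free factor the first step is already enough.\<close>

lemma reach_from_other_factor:
  assumes q: "q \<in> states" "fst q \<noteq> j" and u: "(j, u) \<in> states"
  shows "(q, (j, u)) \<in> edges\<^sup>*"
  using u
proof (induction u)
  case Nil
  then show ?case by (simp add: states_def)
next
  case (Cons s u)
  have j: "j \<le> k" "s \<in> T j" using Cons.prems by (auto simp: states_def)
  show ?case
  proof (cases "u = []")
    case True
    then show ?thesis using edge_switch[OF q(1) j q(2)] by blast
  next
    case False
    then have "j < k" using Cons.prems by (auto simp: states_def)
    then have "((j, u), (j, s # u)) \<in> edges" using edge_extend Cons.prems False by blast
    moreover from this have "(j, u) \<in> states" by blast
    ultimately show ?thesis using Cons.IH by (meson rtrancl.rtrancl_into_rtrancl)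
  qed
qed

text \<open>Two states of one factor are joined by a detour through another factor. If only the free
  factor has letters, three of them leave one that is inverse to neither end, and the path goes
  through it.\<close>

lemma strongly_connected:
  assumes three: "card letters \<ge> 3" and q: "q \<in> states" and r: "r \<in> states"
  shows "(q, r) \<in> edges\<^sup>*"
proof (cases "fst q = fst r")
  case False
  then show ?thesis using reach_from_other_factor[OF q, of "fst r" "snd r"] r by simp
next
  case True
  obtain j where j: "fst q = j" "fst r = j" using True by simp
  show ?thesis
  proof (cases "\<exists>i\<le>k. i \<noteq> j \<and> T i \<noteq> {}")
    case True
    then obtain i s where i: "i \<le> k" "i \<noteq> j" "s \<in> T i" by blast
    have "(q, (i, [s])) \<in> edges" using edge_switch[OF q i(1,3)] i j by simp
    moreover have "((i, [s]), r) \<in> edges\<^sup>*"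
      using reach_from_other_factor[OF single_state[OF i(1,3)], of "fst r" "snd r"] i(2) j r
      unfolding prod.collapse by auto
    ultimately show ?thesis by (rule converse_rtrancl_into_rtrancl)
  next
    case False
    have k: "j = k"
    proof (rule ccontr)
      assume "j \<noteq> k"
      then have "T k = {}" using False by auto
      then obtain a b where "a \<le> k" "b \<le> k" "a \<noteq> b" "T a \<noteq> {}" "T b \<noteq> {}"
        using large by blast
      then show False using False by metis
    qed
    obtain s t where st: "q = (k, [s])" "r = (k, [t])" "s \<in> T k" "t \<in> T k"
      using q r j k by (cases q; cases r) (auto simp: states_def length_Suc_conv)
    interpret group "K k" using grp by simp
    have "letters = {k} \<times> T k" using False k by (auto simp: letters_def)
    then have "card (T k) \<ge> 3" using three by (simp add: card_cartesian_product)
    moreover have "card {inv\<^bsub>K k\<^esub> s, inv\<^bsub>K k\<^esub> t} \<le> 2" by (simp add: card_insert_if)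
    ultimately have "\<not> T k \<subseteq> {inv\<^bsub>K k\<^esub> s, inv\<^bsub>K k\<^esub> t}"
      using card_mono[of "{inv\<^bsub>K k\<^esub> s, inv\<^bsub>K k\<^esub> t}" "T k"] by auto
    then obtain v where v: "v \<in> T k" "v \<noteq> inv\<^bsub>K k\<^esub> s" "v \<noteq> inv\<^bsub>K k\<^esub> t" by blast
    have "t \<noteq> inv\<^bsub>K k\<^esub> v" using v st T_carrier[of k] by auto
    then have "((k, [s]), (k, [v])) \<in> edges" "((k, [v]), (k, [t])) \<in> edges"
      using edge_free v st by blast+
    then show ?thesis unfolding st(1,2) by (meson rtrancl.rtrancl_into_rtrancl r_into_rtrancl)
  qed
qed

text \<open>The walk of length 2 goes to \<open>[t]\<close> and back; the one of length 3 first
  lengthens the block \<open>[s]\<close>. The letter for this exists because \<open>s\<close> and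
  \<open>r\<close> cannot both be the inverse of \<open>s\<close>.\<close>

lemma closed_walks_two_factors:
  assumes i: "i < k" "s \<in> T i" "r \<in> T i" "s \<noteq> r" and j: "j \<le> k" "j \<noteq> i" "t \<in> T j"
  shows "((i, [s]), (i, [s])) \<in> edges ^^ 2" "((i, [s]), (i, [s])) \<in> edges ^^ Suc 2"
proof -
  interpret group "K i" using grp i by simp
  have carr: "s \<in> carrier (K i)" "r \<in> carrier (K i)" using T_carrier[of i] i by auto
  obtain a where a: "a \<in> T i" "a \<noteq> inv\<^bsub>K i\<^esub> s"
    using i carr by (metis inv_inv)
  have ac: "a \<in> carrier (K i)" using T_carrier[of i] i a by auto
  have "a \<otimes>\<^bsub>K i\<^esub> s \<noteq> \<one>\<^bsub>K i\<^esub>" using a carr ac by (metis inv_equality)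
  then have "saw (K i) [a, s]"
    using saw_single[of i s] saw_single[of i a] i a carr ac by (auto simp: prefix_Cons)
  then have "(i, [a, s]) \<in> states" using i a by (auto simp: states_def)
  then have 1: "((i, [s]), (i, [a, s])) \<in> edges" using edge_extend i by simp
  have 2: "((i, [s]), (j, [t])) \<in> edges" "((i, [a, s]), (j, [t])) \<in> edges"
    using edge_switch[OF _ j(1,3)] j(2) single_state[of i s] i \<open>(i, [a, s]) \<in> states\<close> by auto
  have 3: "((j, [t]), (i, [s])) \<in> edges"
    using edge_switch[OF single_state[OF j(1,3)], of i s] i j by auto
  show "((i, [s]), (i, [s])) \<in> edges ^^ 2" by (rule relpow_2_3(1)[OF 2(1) 3])
  show "((i, [s]), (i, [s])) \<in> edges ^^ Suc 2" by (rule relpow_2_3(2)[OF 1 2(2) 3])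
qed

text \<open>A free letter may follow itself, which gives a loop. Without free letters, a third
  letter either shares a factor with one of two given letters, allowing a detour with one extra
  step, or lies in a third factor, giving a triangle.\<close>

lemma aperiodic:
  assumes three: "card letters \<ge> 3"
  obtains q n where "q \<in> states" "(q, q) \<in> edges ^^ n" "(q, q) \<in> edges ^^ Suc n"
proof (cases "T k = {}")
  case False
  then obtain s where s: "s \<in> T k" by blast
  have "((k, [s]), (k, [s])) \<in> edges" using edge_free[OF s s] free_inv[OF s] by metis
  \<comment> \<open>Length 0 is the empty walk, length 1 the loop.\<close>
  then show ?thesis using that[of "(k, [s])" 0] single_state[of k s] s by simp
next
  case True
  then obtain i j where "i \<le> k" "j \<le> k" "i \<noteq> j" "T i \<noteq> {}" "T j \<noteq> {}"
    using large by blast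
  moreover from this True have "i \<noteq> k" "j \<noteq> k" by auto
  ultimately obtain s t where ij: "i < k" "j < k" "i \<noteq> j" "s \<in> T i" "t \<in> T j" by auto
  have "\<not> letters \<subseteq> {(i, s), (j, t)}"
  proof
    assume "letters \<subseteq> {(i, s), (j, t)}"
    then have "card letters \<le> card {(i, s), (j, t)}" by (intro card_mono) auto
    also have "\<dots> \<le> 2" by (simp add: card_insert_if)
    finally show False using three by simp
  qed
  then obtain l r where l: "l \<le> k" "r \<in> T l" "(l, r) \<noteq> (i, s)" "(l, r) \<noteq> (j, t)"
    by (auto simp: letters_def)
  consider "l = i" | "l = j" | "l \<noteq> i" "l \<noteq> j" by blast
  then show ?thesis
  proof cases
    case 1
    then show ?thesis
      using that[of "(i, [s])" 2] closed_walks_two_factors[of i s r j t] single_state[of i s] ij l by auto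
  next
    case 2
    then show ?thesis
      using that[of "(j, [t])" 2] closed_walks_two_factors[of j t r i s] single_state[of j t] ij l by auto
  next
    case 3
    have st: "(i, [s]) \<in> states" "(j, [t]) \<in> states" "(l, [r]) \<in> states"
      using single_state ij l by auto
    have e: "((i, [s]), (j, [t])) \<in> edges" "((j, [t]), (i, [s])) \<in> edges"
      "((j, [t]), (l, [r])) \<in> edges" "((l, [r]), (i, [s])) \<in> edges"
      using edge_switch[OF st(1), of j t] edge_switch[OF st(2), of i s] edge_switch[OF st(2), of l r]
        edge_switch[OF st(3), of i s] ij l 3 by auto
    show ?thesis
      using that[OF st(1) relpow_2_3(1)[OF e(1,2)] relpow_2_3(2)[OF e(1,3,4)]] .
  qed
qed

text \<open>The inverse of the first letter of the block would step straight back. So every state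
  has strictly fewer successors than there are letters.\<close>

lemma letter_not_readable:
  assumes q: "q \<in> states"
  shows "\<exists>x\<in>letters. x \<notin> readable q"
proof -
  obtain i s u where iu: "q = (i, s # u)" using q by (cases q; cases "snd q") (auto simp: states_def)
  have i: "i \<le> k" "s \<in> T i" using q iu by (auto simp: states_def)
  interpret group "K i" using grp i by simp
  have "s \<in> carrier (K i)" using T_carrier i by blast
  then have "word_prod (K i) [inv\<^bsub>K i\<^esub> s, s] = \<one>\<^bsub>K i\<^esub>" by simp
  moreover have "prefix [s] (s # u)" by simp
  ultimately have "\<not> saw (K i) (inv\<^bsub>K i\<^esub> s # s # u)" by (metis saw.simps(2))
  moreover have "(i, inv\<^bsub>K i\<^esub> s) \<in> letters" using i T_inv by (auto simp: letters_def)
  ultimately show ?thesis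
    using iu by (intro bexI[of _ "(i, inv\<^bsub>K i\<^esub> s)"]) (auto simp: readable_def)
qed

text \<open>
  With two letters (\<open>\<int>\<close> and the infinite dihedral group) walks cannot branch, so \<open>l = 1\<close>; otherwise
  the state graph is strongly connected and aperiodic, and Perron-Frobenius applies.
\<close>

lemma language_limit_perron:
  obtains l where "perron_number l" "(\<lambda>n. root n (card (language n))) \<longlonglongrightarrow> l"
proof -
  obtain x where x: "0 < x" "x \<le> 1" "total_weight x = 1" by (rule total_weight_root)
  define l where "l = 1 / x"
  have l: "l \<ge> 1" using x by (simp add: l_def)
  have pos: "weight x q > 0" if "q \<in> states" for q using weight_pos that x by simp
  have eigen: "(\<Sum>y\<in>readable q. weight x (after q y)) = l * weight x q" if "q \<in> states" for q
    using weight_eigen[OF x(1,3) that] by (simp add: l_def)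
  have lim: "(\<lambda>n. root n (card (language n))) \<longlonglongrightarrow> l"
    by (rule language_growth[of "weight x"]) (use pos eigen l in auto)
  have "perron_number l"
  proof (cases "l = 1")
    case True
    then show ?thesis using perron_number_one by simp
  next
    case False
    have three: "card letters \<ge> 3"
    proof (rule ccontr)
      assume two: "\<not> card letters \<ge> 3"
      \<comment> \<open>At a state of maximal weight with at most one readable letter, the
        eigenvector equation gives \<open>l \<le> 1\<close>.\<close>
      obtain q where q: "q \<in> states" "\<And>r. r \<in> states \<Longrightarrow> weight x r \<le> weight x q"
      proof -
        obtain y where "y \<in> letters" using letters_nonempty by blast
        then have "(fst y, [snd y]) \<in> states" using single_state by (auto simp: letters_def)
        then have "Max (weight x ` states) \<in> weight x ` states"
          using finite_states by (intro Max_in) auto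
        then obtain q where q: "q \<in> states" "Max (weight x ` states) = weight x q" by auto
        have "weight x r \<le> weight x q" if "r \<in> states" for r
          unfolding q(2)[symmetric] using that finite_states by (intro Max_ge) auto
        then show ?thesis using that[OF q(1)] by blast
      qed
      have "readable q \<subset> letters"
        using letter_not_readable[OF q(1)] by (auto simp: readable_def)
      then have "card (readable q) < card letters" by (rule psubset_card_mono[OF finite_letters])
      then have "card (readable q) \<le> 1" using two by simp
      have "l * weight x q = (\<Sum>y\<in>readable q. weight x (after q y))" using eigen[OF q(1)] by simp
      also have "\<dots> \<le> card (readable q) * weight x q"
        using q after_state by (intro sum_bounded_above) auto
      also have "\<dots> \<le> 1 * weight x q"
        using \<open>card (readable q) \<le> 1\<close> pos[OF q(1)] by (intro mult_right_mono) auto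
      finally have "l \<le> 1" using pos[OF q(1)] by simp
      then show False using l False by simp
    qed
    obtain q n where q: "q \<in> states" "(q, q) \<in> edges ^^ n" "(q, q) \<in> edges ^^ Suc n"
      using aperiodic[OF three] by blast
    have sum: "(\<Sum>r\<in>successors q. weight x r) = l * weight x q" if "q \<in> states" for q
      unfolding successors_def using eigen[OF that] after_inj by (subst sum.reindex) auto
    have sub: "successors q \<subseteq> states" if "q \<in> states" for q
      unfolding successors_def using after_state[OF that] by blast
    show ?thesis
      by (rule positive_eigenvalue_perron[OF finite_states sub pos sum l strongly_connected[OF three] q])
  qed
  then show ?thesis using that lim by blast
qed

end

section \<open>Free groups\<close>

text \<open>A reduced word is its own normal form, so no nonempty subword of it is trivial. In any
  other word some adjacent pair cancels and is itself a trivial subword.\<close>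

lemma saw_free_group:
  "saw (free_group B) (map (\<lambda>y. [y]) w) \<longleftrightarrow> successively (\<lambda>(x, b) (y, c). \<not> (x = y \<and> b \<noteq> c)) w"
proof (induction w)
  case (Cons p w)
  let ?red = "successively (\<lambda>(x, b) (y, c). \<not> (x = y \<and> b \<noteq> c)) :: ('a \<times> bool) list \<Rightarrow> bool"
  have prod: "word_prod (free_group B) (map (\<lambda>y. [y]) u) = foldr fg_cons u []" for u
    by (induction u) (auto simp: free_group_def)
  have one: "\<one>\<^bsub>free_group B\<^esub> = []" by (simp add: free_group_def)
  have reduced: "foldr fg_cons u [] = u" if "?red u" for u
    using that
  proof (induction u)
    case (Cons q u)
    then have "foldr fg_cons u [] = u" by (cases u) auto
    then show ?case using Cons.prems by (cases q; cases u) auto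
  qed simp
  have pre: "prefix v (map (\<lambda>y. [y]) w) \<longleftrightarrow> (\<exists>u. prefix u w \<and> v = map (\<lambda>y. [y]) u)" for v
    by (auto simp: map_mono_prefix dest: prefix_map_rightE)
  have "word_prod (free_group B) ([p] # map (\<lambda>y. [y]) u) = foldr fg_cons (p # u) []" for u
    using prod[of "p # u"] by simp
  then have "saw (free_group B) (map (\<lambda>y. [y]) (p # w)) \<longleftrightarrow>
      (\<forall>u. prefix u w \<longrightarrow> foldr fg_cons (p # u) [] \<noteq> []) \<and> ?red w"
    using Cons.IH pre one by (auto simp del: word_prod_Cons)
  also have "\<dots> \<longleftrightarrow> ?red (p # w)"
  proof (intro iffI conjI allI impI)
    assume L: "(\<forall>u. prefix u w \<longrightarrow> foldr fg_cons (p # u) [] \<noteq> []) \<and> ?red w"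
    show "?red (p # w)"
    proof (cases w)
      case (Cons q v)
      then have "prefix [q] w" by simp
      then have "foldr fg_cons (p # [q]) [] \<noteq> []" using L by blast
      then show ?thesis using L Cons by (cases p; cases q) (auto split: if_splits)
    qed simp
  next
    fix u assume R: "?red (p # w)" and u: "prefix u w"
    obtain z where "w = u @ z" using u by (auto simp: prefix_def)
    then have "?red (p # u)" using R by (simp add: successively_append_iff flip: append_Cons)
    then show "foldr fg_cons (p # u) [] \<noteq> []" using reduced by (metis list.distinct(1))
  next
    assume "?red (p # w)"
    then show "?red w" by (cases w) auto
  qed
  finally show ?case .
qed simp

context
  fixes F :: "('a, 'c) monoid_scheme" and B X :: "'a set"
  assumes F: "group F" and B: "free_basis F B"
  defines "X \<equiv> B \<union> m_inv F ` B"
begin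

text \<open>Letters of \<open>X\<close> become one-letter words and inversion becomes a change of
  sign, so questions about \<open>X\<close> reduce to reduced words.\<close>

lemma free_basis_iso:
  obtains \<psi> where "\<psi> \<in> iso (free_group B) F" "X = (\<lambda>y. \<psi> [y]) ` (B \<times> UNIV)"
    "\<And>b c. b \<in> B \<Longrightarrow> inv\<^bsub>F\<^esub> (\<psi> [(b, c)]) = \<psi> [(b, \<not> c)]"
proof -
  obtain \<psi> where \<psi>: "\<psi> \<in> iso (free_group B) F" "\<And>b. b \<in> B \<Longrightarrow> \<psi> [(b, True)] = b"
    using B by (auto simp: free_basis_def)
  interpret F: group F by (fact F)
  interpret P: group "free_group B" by (rule free_group_group)
  interpret group_hom "free_group B" F \<psi>
    by unfold_locales (use \<psi>(1) in \<open>simp add: iso_def\<close>)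
  have single: "[(b, c)] \<in> carrier (free_group B)" if "b \<in> B" for b c
    using that by (simp add: free_group_def)
  have inv: "inv\<^bsub>F\<^esub> (\<psi> [(b, c)]) = \<psi> [(b, \<not> c)]" if "b \<in> B" for b c
  proof -
    have "[(b, \<not> c)] \<otimes>\<^bsub>free_group B\<^esub> [(b, c)] = \<one>\<^bsub>free_group B\<^esub>" by (simp add: free_group_def)
    then have "inv\<^bsub>free_group B\<^esub> [(b, c)] = [(b, \<not> c)]"
      using single[OF that] by (intro P.inv_equality) auto
    then show ?thesis using hom_inv[OF single[OF that, of c]] by simp
  qed
  have "X = (\<lambda>y. \<psi> [y]) ` (B \<times> UNIV)"
  proof (intro equalityI subsetI)
    fix s assume "s \<in> X"
    then consider "s \<in> B" | b where "b \<in> B" "s = inv\<^bsub>F\<^esub> b" by (auto simp: X_def)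
    then show "s \<in> (\<lambda>y. \<psi> [y]) ` (B \<times> UNIV)"
    proof cases
      case 1
      then show ?thesis using \<psi>(2)[OF 1] by (intro image_eqI[of _ _ "(s, True)"]) auto
    next
      case 2
      then have "s = \<psi> [(b, False)]" using inv[OF 2(1), of True] \<psi>(2)[OF 2(1)] by simp
      then show ?thesis using 2 by (intro image_eqI[of _ _ "(b, False)"]) auto
    qed
  next
    fix s assume "s \<in> (\<lambda>y. \<psi> [y]) ` (B \<times> UNIV)"
    then obtain b c where s: "b \<in> B" "s = \<psi> [(b, c)]" by auto
    show "s \<in> X"
    proof (cases c)
      case True
      then show ?thesis using s \<psi>(2) by (simp add: X_def)
    next
      case False
      then have "s = inv\<^bsub>F\<^esub> b" using inv[OF s(1), of True] \<psi>(2)[OF s(1)] s by simp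
      then show ?thesis using s by (simp add: X_def)
    qed
  qed
  with \<psi>(1) inv show ?thesis by (intro that) auto
qed

lemma free_basis_subset: "X \<subseteq> carrier F"
proof -
  interpret group F by (fact F)
  obtain \<psi> where "\<psi> \<in> iso (free_group B) F" "\<And>b. b \<in> B \<Longrightarrow> \<psi> [(b, True)] = b"
    using B by (auto simp: free_basis_def)
  moreover have "[(b, True)] \<in> carrier (free_group B)" if "b \<in> B" for b
    using that by (simp add: free_group_def)
  ultimately have "B \<subseteq> carrier F" by (metis Group.iso_imp_homomorphism hom_in_carrier subsetI)
  then show ?thesis by (auto simp: X_def)
qed

text \<open>Since \<open>t # u\<close> corresponds to a reduced word, only the new adjacent pair
  \<open>s\<close>, \<open>t\<close> can cancel.\<close>

lemma free_basis_saw: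
  assumes "set (s # t # u) \<subseteq> X" "saw F (t # u)"
  shows "saw F (s # t # u) \<longleftrightarrow> s \<noteq> inv\<^bsub>F\<^esub> t"
proof -
  obtain \<psi> where \<psi>: "\<psi> \<in> iso (free_group B) F" "X = (\<lambda>y. \<psi> [y]) ` (B \<times> UNIV)"
    "\<And>b c. b \<in> B \<Longrightarrow> inv\<^bsub>F\<^esub> (\<psi> [(b, c)]) = \<psi> [(b, \<not> c)]"
    using free_basis_iso by blast
  have hom: "\<psi> \<in> hom (free_group B) F" "inj_on \<psi> (carrier (free_group B))"
    using \<psi>(1) by (auto simp: iso_def bij_betw_def)
  obtain p where p: "p \<in> B \<times> UNIV" "s = \<psi> [p]" using assms(1) \<psi>(2) by auto
  obtain q where q: "q \<in> B \<times> UNIV" "t = \<psi> [q]" using assms(1) \<psi>(2) by auto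
  have "u \<in> lists ((\<lambda>y. \<psi> [y]) ` (B \<times> UNIV))" using assms(1) \<psi>(2) by auto
  then obtain v where v: "set v \<subseteq> B \<times> UNIV" "u = map (\<lambda>y. \<psi> [y]) v"
    unfolding lists_image by auto
  have saw: "saw F (map (\<lambda>y. \<psi> [y]) z) \<longleftrightarrow> successively (\<lambda>(x, b) (y, c). \<not> (x = y \<and> b \<noteq> c)) z"
    if "set z \<subseteq> B \<times> UNIV" for z
  proof -
    have "set (map (\<lambda>y. [y]) z) \<subseteq> carrier (free_group B)"
      using that by (auto simp: free_group_def)
    from saw_map_hom[OF free_group_group F hom this]
    show ?thesis by (simp add: saw_free_group o_def)
  qed
  have single: "[(b, c)] \<in> carrier (free_group B)" if "b \<in> B" for b c
    using that by (simp add: free_group_def)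
  have "saw F (s # t # u) \<longleftrightarrow> \<not> (fst p = fst q \<and> snd p \<noteq> snd q)"
    using saw[of "p # q # v"] saw[of "q # v"] p q v assms(2)
    by (auto simp: case_prod_unfold simp del: saw.simps)
  moreover have "s = inv\<^bsub>F\<^esub> t \<longleftrightarrow> fst p = fst q \<and> snd p \<noteq> snd q"
  proof -
    obtain b c b' c' where pq: "p = (b, c)" "q = (b', c')" "b \<in> B" "b' \<in> B" using p q by auto
    then have "s = inv\<^bsub>F\<^esub> t \<longleftrightarrow> \<psi> [(b, c)] = \<psi> [(b', \<not> c')]" using p q \<psi>(3) by simp
    also have "\<dots> \<longleftrightarrow> [(b, c)] = [(b', \<not> c')]"
      by (rule inj_on_eq_iff[OF hom(2) single[OF pq(3)] single[OF pq(4)]])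
    finally show ?thesis using pq by auto
  qed
  ultimately show ?thesis by blast
qed

text \<open>The two signs of a basis element are distinct reduced words, and the isomorphism is
  injective.\<close>

lemma free_basis_inv_neq: "s \<in> X \<Longrightarrow> inv\<^bsub>F\<^esub> s \<noteq> s"
proof -
  assume s: "s \<in> X"
  obtain \<psi> where \<psi>: "\<psi> \<in> iso (free_group B) F" "X = (\<lambda>y. \<psi> [y]) ` (B \<times> UNIV)"
    "\<And>b c. b \<in> B \<Longrightarrow> inv\<^bsub>F\<^esub> (\<psi> [(b, c)]) = \<psi> [(b, \<not> c)]"
    using free_basis_iso by blast
  have inj: "inj_on \<psi> (carrier (free_group B))"
    using \<psi>(1) by (auto simp: iso_def bij_betw_def)
  obtain b c where bc: "b \<in> B" "s = \<psi> [(b, c)]" using s \<psi>(2) by auto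
  have "[(b, c)] \<in> carrier (free_group B)" "[(b, \<not> c)] \<in> carrier (free_group B)"
    using bc by (auto simp: free_group_def)
  then show ?thesis using inj_onD[OF inj, of "[(b, \<not> c)]" "[(b, c)]"] bc \<psi>(3) by auto
qed

lemma free_basis_empty: "X = {} \<Longrightarrow> carrier F = {\<one>\<^bsub>F\<^esub>}"
proof -
  assume "X = {}"
  then have "B = {}" by (simp add: X_def)
  then have "carrier (free_group B) = {[]}" by (auto simp: free_group_def)
  moreover obtain \<psi> where "\<psi> \<in> iso (free_group B) F" using B by (auto simp: free_basis_def)
  ultimately have a: "carrier F = {\<psi> []}" by (auto simp: iso_def bij_betw_def)
  interpret group F by (fact F)
  show ?thesis using a one_closed by simp
qed

end

section \<open>Transfer to the plain group\<close>

theorem corollary4p7: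
  fixes G :: "('a, 'b) monoid_scheme" and S :: "'a set"
  assumes "plain_group G"
    and "infinite (carrier G)"
    and "standard_generating_set G S"
  shows "\<exists>(l::real) (q::rat). perron_number l \<and> q \<ge> 0 \<and>
           connective_constant G S = l powr of_rat q"
proof -
  interpret G: group G using assms(1) by (simp add: plain_group_def)
  obtain k m H \<phi> T B where gen: "generating_set G S" and dec: "plain_decomposition G k m H \<phi>"
    and genT: "\<forall>i<k. generating_set (H i) (T i)"
    and B: "free_basis (free_group {..<m}) B" and Tk: "T k = B \<union> m_inv (free_group {..<m}) ` B"
    and S: "S = (\<Union>i\<le>k. (\<lambda>t. \<phi> (fp_inj (plain_factors k m H) i t)) ` T i)"
    using assms(3) unfolding standard_generating_set_def Let_def by blast
  define K where "K = plain_factors k m H"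
  define P where "P = free_product {..k} K"
  have K: "K i = H i" if "i < k" for i using that by (simp add: K_def plain_factors_def)
  have Kk: "K k = free_group {..<m}" by (simp add: K_def plain_factors_def)
  have H: "group (H i)" "finite (carrier (H i))" if "i < k" for i
    using dec that by (auto simp: plain_decomposition_def)
  have grpK: "group (K i)" if "i \<le> k" for i
    using that H K Kk free_group_group by (cases "i = k") auto
  have grpK': "\<forall>i\<in>{..k}. group (K i)" using grpK by simp
  have \<phi>: "\<phi> \<in> iso P G" using dec by (simp add: plain_decomposition_def P_def K_def)
  then have hom: "\<phi> \<in> hom P G" and inj: "inj_on \<phi> (carrier P)" and surj: "\<phi> ` carrier P = carrier G"
    by (auto simp: iso_def bij_betw_def)
  interpret P: group P unfolding P_def by (rule free_product_group[OF grpK'])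
  interpret \<phi>: group_hom P G \<phi> by unfold_locales (fact hom)
  have S: "S = (\<Union>i\<le>k. (\<lambda>t. \<phi> (fp_inj K i t)) ` T i)" using S by (simp add: K_def)
  have S_fin: "finite S" "S \<subseteq> carrier G" "\<one>\<^bsub>G\<^esub> \<notin> S" using gen by (auto simp: generating_set_def)
  have T_carrier: "T i \<subseteq> carrier (K i)" if "i \<le> k" for i
    using that genT K Kk free_basis_subset[OF free_group_group B] Tk
    by (cases "i = k") (auto simp: generating_set_def)
  \<comment> \<open>\<open>fp_inj\<close> sends the identity of a factor to the empty word, so an
    identity in \<open>T i\<close> would put the identity of \<open>G\<close> into \<open>S\<close>.
    This treats finite and free factors alike.\<close>
  have T_one: "\<one>\<^bsub>K i\<^esub> \<notin> T i" if "i \<le> k" for i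
  proof
    assume "\<one>\<^bsub>K i\<^esub> \<in> T i"
    then have "\<phi> (fp_inj K i \<one>\<^bsub>K i\<^esub>) \<in> S" using S that by blast
    moreover have "fp_inj K i \<one>\<^bsub>K i\<^esub> = \<one>\<^bsub>P\<^esub>" by (simp add: fp_inj_def P_def free_product_def)
    ultimately show False using S_fin(3) by simp
  qed
  define L where "L = (SIGMA i:{..k}. T i)"
  define e where "e x = \<phi> [x]" for x
  have L_carrier: "[x] \<in> carrier P" if "x \<in> L" for x
    using that T_carrier T_one by (auto simp: L_def P_def free_product_def)
  have e_inj: "inj_on e L"
    using inj L_carrier unfolding e_def inj_on_def by blast
  have eS: "e ` L = S"
  proof -
    have "\<phi> (fp_inj K i t) = e (i, t)" if "i \<le> k" "t \<in> T i" for i t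
      using T_one that by (auto simp: fp_inj_def e_def)
    then show ?thesis unfolding S L_def by (auto simp: image_iff)
  qed
  \<comment> \<open>\<open>L\<close> is in bijection with the finite set \<open>S\<close>; in
    particular \<open>T k\<close> is finite.\<close>
  have "finite L" using e_inj eS S_fin(1) finite_imageD by metis
  have T_finite: "finite (T i)" if "i \<le> k" for i
  proof -
    have "T i \<subseteq> snd ` L" using that by (force simp: L_def)
    then show ?thesis using \<open>finite L\<close> finite_subset by blast
  qed
  have T_inv: "inv\<^bsub>K i\<^esub> s \<in> T i" if "i \<le> k" "s \<in> T i" for i s
  proof (cases "i = k")
    case True
    interpret group "free_group {..<m}" by (rule free_group_group)
    show ?thesis
      using that Tk Kk True free_basis_subset[OF free_group_group B] by auto
  next
    case False
    then show ?thesis using that genT K by (auto simp: generating_set_def)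
  qed
  have trivial: "carrier (K i) = {\<one>\<^bsub>K i\<^esub>}" if "i \<le> k" "T i = {}" for i
  proof (cases "i = k")
    case True
    then show ?thesis using free_basis_empty[OF free_group_group B] that Tk Kk by simp
  next
    case False
    then have "i < k" using that by simp
    then interpret group "H i" using H by simp
    have "generate (H i) (T i) = carrier (H i)"
      using genT \<open>i < k\<close> by (simp add: generating_set_def)
    then show ?thesis using K[OF \<open>i < k\<close>] that(2) generate_empty by simp
  qed
  have large: "T k \<noteq> {} \<or> (\<exists>i\<le>k. \<exists>j\<le>k. i \<noteq> j \<and> T i \<noteq> {} \<and> T j \<noteq> {})"
  proof (rule ccontr)
    \<comment> \<open>Otherwise at most one factor is nontrivial, and it is finite. Reduced words
      then have length at most 1 over a finite alphabet, so the group would be finite.\<close>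
    assume small: "\<not> ?thesis"
    define A where "A = (SIGMA i:{..<k}. carrier (H i))"
    have letter: "fst x \<le> k \<and> T (fst x) \<noteq> {} \<and> x \<in> A" if "w \<in> carrier P" "x \<in> set w" for x w
    proof -
      obtain i a where x: "x = (i, a)" by force
      have i: "i \<le> k" "a \<in> carrier (K i)" "a \<noteq> \<one>\<^bsub>K i\<^esub>"
        using that x by (auto simp: P_def free_product_def)
      then have "T i \<noteq> {}" using trivial[of i] by auto
      moreover from this small have "i \<noteq> k" by auto
      ultimately show ?thesis using i x K by (auto simp: A_def)
    qed
    have "carrier P \<subseteq> {w. set w \<subseteq> A \<and> length w \<le> 1}"
    proof (intro subsetI CollectI conjI)
      fix w assume w: "w \<in> carrier P"
      show "x \<in> A" if "x \<in> set w" for x using letter[OF w that] by blast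
      show "length w \<le> 1"
      proof (rule ccontr)
        assume "\<not> length w \<le> 1"
        then obtain x y v where xy: "w = x # y # v" by (cases w; cases "tl w") auto
        then have "fst x \<noteq> fst y" using w by (auto simp: P_def free_product_def)
        then show False using letter[OF w, of x] letter[OF w, of y] xy small by auto
      qed
    qed
    moreover have "finite A" using H by (auto simp: A_def)
    ultimately have "finite (carrier P)" using finite_subset[OF _ finite_lists_length_le] by blast
    then show False using surj assms(2) by (metis finite_imageI)
  qed
  interpret standard_system k K T
  proof (rule standard_system.intro)
    show "finite (carrier (K i))" if "i < k" for i using that H K by simp
    show "saw (K k) (s # t # u) \<longleftrightarrow> s \<noteq> inv\<^bsub>K k\<^esub> t"
      if "set (s # t # u) \<subseteq> T k" "saw (K k) (t # u)" for s t u
      using free_basis_saw[OF free_group_group B] that Tk Kk by simp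
    show "inv\<^bsub>K k\<^esub> s \<noteq> s" if "s \<in> T k" for s
      using free_basis_inv_neq[OF free_group_group B] that Tk Kk by simp
  qed (fact grpK T_finite T_carrier T_one T_inv large)+
  have letters: "letters = L" by (simp add: letters_def L_def)
  have saw: "saw G (map e w) \<longleftrightarrow> fp_saw K w" if "set w \<subseteq> L" for w
  proof -
    have "set (map (\<lambda>x. [x]) w) \<subseteq> carrier P" using that L_carrier by auto
    from saw_map_hom[OF P.is_group G.is_group hom inj this]
    have "saw G (map e w) \<longleftrightarrow> saw P (map (\<lambda>x. [x]) w)" by (simp add: e_def[abs_def] o_def)
    moreover have "set w \<subseteq> (SIGMA i:{..k}. carrier (K i))"
      using that T_carrier by (fastforce simp: L_def)
    ultimately show ?thesis using saw_free_product[OF grpK'] by (simp add: P_def)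
  qed
  have "saw_count G S n = card (language n)" for n
  proof -
    have "{w. length w = n \<and> set w \<subseteq> S \<and> saw G w} = map e ` language n"
    proof (intro equalityI subsetI)
      fix w assume w: "w \<in> {w. length w = n \<and> set w \<subseteq> S \<and> saw G w}"
      then have "w \<in> lists (e ` L)" using eS by auto
      then obtain v where "set v \<subseteq> L" "w = map e v" unfolding lists_image by auto
      then show "w \<in> map e ` language n" using w saw letters by (auto simp: language_def)
    next
      fix w assume "w \<in> map e ` language n"
      then obtain v where v: "v \<in> language n" "w = map e v" by blast
      moreover from this have "set v \<subseteq> L" using letters by (auto simp: language_def)
      moreover from this have "set (map e v) \<subseteq> S" using eS by auto
      ultimately show "w \<in> {w. length w = n \<and> set w \<subseteq> S \<and> saw G w}"
        using saw by (auto simp: language_def)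
    qed
    moreover have "inj_on (map e) (language n)"
      by (rule inj_on_subset[OF inj_on_map_lists[OF e_inj]]) (auto simp: language_def letters)
    ultimately show ?thesis
      using G.saw_count_eq[OF S_fin(2)] by (simp add: card_image)
  qed
  moreover obtain l where l: "perron_number l" "(\<lambda>n. root n (card (language n))) \<longlonglongrightarrow> l"
    by (rule language_limit_perron)
  ultimately have "connective_constant G S = l"
    unfolding connective_constant_def by (simp add: limI)
  moreover have "l > 0" using l(1) by (simp add: perron_number_def)
  ultimately show ?thesis using l(1) by (intro exI[of _ l] exI[of _ 1]) simp
qed

end
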